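(* Let $(\mu(t,\cdot))_{t\in[0,\infty)}$ be the hydrodynamic limit process of the Dyson model (as described in the context). Assume that $\mu(t,\cdot)$ has a probability density function $\rho(t,\cdot)$ for every $t\in[0,\infty)$, so that its Green's function is given by $$G(t,z)=\int_{\mathbb{R}}\frac{\rho(t,x)}{z-x}\,dx,\qquad t\in[0,\infty),\ z\in\mathbb{C}\setminus\mathbb{R},$$ and assume that $\rho$ satisfies the following two conditions. (1) $\rho(t,x)$ is piecewise differentiable with respect to $t\in(0,\infty)$ and $x\in\mathbb{R}$, with piecewise-defined derivatives $\frac{\partial\rho(t,x)}{\partial t}$ and $\frac{\partial\rho(t,x)}{\partial x}$. (2) For each $t\in(0,\infty)$, the functions $\rho(t,\cdot)$, $\frac{\partial\rho(t,\cdot)}{\partial t}$ and $\frac{\partial\rho(t,\cdot)}{\partial x}$ belong to $L^p(\mathbb{R})$ with $1<p<\infty$ (so that their Hilbert transforms are well-defined). Then the partial differential equation $$\frac{\partial G(t,z)}{\partial t}+G(t,z)\frac{\partial G(t,z)}{\partial z}=0,\qquad t\in[0,\infty),\ z\in\mathbb{C}\setminus\mathbb{R},$$ satisfied by $G$ implies both of the following. (i) The density $\rho$ satisfies $$\frac{\partial\rho(t,x)}{\partial t}+\pi\frac{\partial}{\partial x}\Big\{\rho(t,x)\,\mathcal{H}[\rho(t,\cdot)](x)\Big\}=0,\qquad t\in(0,\infty),\ x\in\mathbb{R},$$ where derivatives are understood as piecewise-defined. (ii) The Green's function $G$ solves the functional equation $$G(t,z)=G\big(0,\,z-t\,G(t,z)\big),\qquad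 t\in[0,\infty),\ z\in\mathbb{C}\setminus\mathbb{R}.$$
   Context: **Hilbert transform.** For $f\in L^p(\mathbb{R})$, $1<p<\infty$, $$\mathcal{H}[f](x):=\frac1\pi\lim_{\varepsilon\downarrow0}\left\{\int_{-\infty}^{x-\varepsilon}\frac{f(y)}{x-y}\,dy+\int_{x+\varepsilon}^{\infty}\frac{f(y)}{x-y}\,dy\right\},\qquad x\in\mathbb{R}$$ (Cauchy principal value). **Derivatives.** For piecewise differentiable functions, all derivatives are understood as piecewise-defined. **Dyson model.** Let $\beta\ge1$, let $\mathbf{B}=(B_1,\dots,B_N)$ be an $N$-dimensional standard Brownian motion, and let $\overline{\mathbb{W}}_N=\{\mathbf{x}\in\mathbb{R}^N: x_1\le x_2\le\dots\le x_N\}$. The ($N$-particle, time-changed) Dyson model $\mathbf{X}^N=(X_1^N,\dots,X_N^N)$ is the solution of $$dX_i^N(t)=\sqrt{\frac{2}{\beta N}}\,dB_i(t)+\frac1N\sum_{1\le j\le N,\ j\ne i}\frac{dt}{X_i^N(t)-X_j^N(t)},\qquad t\ge0,\ 1\le i\le N,$$ with $\mathbf{X}^N(0)=\mathbf{x}^N\in\overline{\mathbb{W}}_N$. Its empirical measure is $\Xi^N(t,\cdot)=\frac1N\sum_{i=1}^N\delta_{X_i^N(t)}(\cdot)$. **Hydrodynamic limit process.** Let $\mathfrak{M}$ be the space of probability measures on $\mathbb{R}$ with the weak topology. Suppose that $\sup_{N\in\mathbb{N}}\frac1N\sum_{i=1}^N\log\{(x_i^N)^2+1\}<\infty$ and that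 $\Xi^N(0,\cdot)$ converges weakly to some $\mu(\cdot)\in\mathfrak{M}$ as $N\to\infty$. It is a known theorem (Anderson, Guionnet, Zeitouni) that, for every $T<\infty$, $(\Xi^N(t,\cdot))_{t\in[0,T]}$ converges almost surely in the space $C([0,T]\to\mathfrak{M})$ of continuous $\mathfrak{M}$-valued paths to a unique limit $(\mu(t,\cdot))_{t\in[0,T]}$ with $\mu(0,\cdot)=\mu(\cdot)$. Its Green's function (Stieltjes transform) $G(t,z)=\int_{\mathbb{R}}\frac{d\mu(t,x)}{z-x}$ satisfies $\frac{\partial G}{\partial t}+G\frac{\partial G}{\partial z}=0$ for $t\in[0,T]$, $z\in\mathbb{C}\setminus\mathbb{R}$. The process $(\mu(t,\cdot))_{t\in[0,\infty)}$ is the hydrodynamic limit of the Dyson model. **Density.** That $\mu(t,\cdot)$ has a density means $\mu(t,A)=\int_A\rho(t,x)\,dx$ for every Borel set $A\subset\mathbb{R}$ and every $t\in[0,\infty)$. At $t=0$ the paper also uses this notation formally when $\mu(0,\cdot)$ is a sum of point masses (writing $\rho(0,x)$ as a sum of Dirac delta functions); in that case $\rho(0,x)\,dx$ stands for $\mu(0,dx)$. **Integrability exponents.** In condition (2), "belong to $L^p(\mathbb{R})$ with $1<p<\infty$" means for some such exponent $p$. *)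

theory Defs
  imports "HOL-Analysis.Analysis" "HOL-Probability.Probability"
begin

(* N-dimensional standard Brownian motion (components 1..N), by the law of its increments:
   they are centred Gaussian, and those over consecutive time intervals, for all components
   at once, form one independent family. *)
definition standard_brownian_motion ::
  "'w measure \<Rightarrow> nat \<Rightarrow> (nat \<Rightarrow> real \<Rightarrow> 'w \<Rightarrow> real) \<Rightarrow> bool" where
  "standard_brownian_motion M N B \<longleftrightarrow>
     (\<forall>i\<in>{1..N}. \<forall>t\<ge>0. B i t \<in> borel_measurable M) \<and>
     (AE \<omega> in M. \<forall>i\<in>{1..N}. B i 0 \<omega> = 0 \<and> continuous_on {0..} (\<lambda>t. B i t \<omega>)) \<and>
     (\<forall>i\<in>{1..N}. \<forall>s\<ge>0. \<forall>t>s.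
        distributed M lborel (\<lambda>\<omega>. B i t \<omega> - B i s \<omega>)
          (\<lambda>x. ennreal (normal_density 0 (sqrt (t - s)) x))) \<and>
     (\<forall>\<tau>::nat \<Rightarrow> real. 0 \<le> \<tau> 0 \<and> strict_mono \<tau> \<longrightarrow>
        prob_space.indep_vars M (\<lambda>_. borel)
          (\<lambda>(i, k) \<omega>. B i (\<tau> (Suc k)) \<omega> - B i (\<tau> k) \<omega>) ({1..N} \<times> UNIV))"

definition weyl_chamber :: "nat \<Rightarrow> (nat \<Rightarrow> real) set" where
  "weyl_chamber N = {x. \<forall>i\<in>{1..N}. \<forall>j\<in>{1..N}. i \<le> j \<longrightarrow> x i \<le> x j}"

(* The noise is additive, so the stochastic differential equation, in integral form, is an
   identity between paths and needs no stochastic integral. For beta >= 1 the particles do not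
   collide at positive times, also when some of them start at the same point; this is
   part of the notion of solution here, so that no denominator in the drift vanishes for t > 0. *)
definition dyson_model ::
  "'w measure \<Rightarrow> real \<Rightarrow> nat \<Rightarrow> (nat \<Rightarrow> real) \<Rightarrow> (nat \<Rightarrow> real \<Rightarrow> 'w \<Rightarrow> real) \<Rightarrow>
   (nat \<Rightarrow> real \<Rightarrow> 'w \<Rightarrow> real) \<Rightarrow> bool" where
  "dyson_model M \<beta> N x B X \<longleftrightarrow>
     x \<in> weyl_chamber N \<and>
     standard_brownian_motion M N B \<and>
     (\<forall>i\<in>{1..N}. \<forall>t\<ge>0. X i t \<in> borel_measurable M) \<and>
     (AE \<omega> in M.
        (\<forall>i\<in>{1..N}. X i 0 \<omega> = x i \<and> continuous_on {0..} (\<lambda>t. X i t \<omega>)) \<and>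
        (\<forall>t>0. \<forall>i\<in>{1..N}. \<forall>j\<in>{1..N}. i < j \<longrightarrow> X i t \<omega> < X j t \<omega>) \<and>
        (\<forall>t\<ge>0. \<forall>i\<in>{1..N}.
           set_integrable lborel {0..t} (\<lambda>s. \<Sum>j\<in>{1..N} - {i}. 1 / (X i s \<omega> - X j s \<omega>)) \<and>
           X i t \<omega> = x i + sqrt (2 / (\<beta> * real N)) * B i t \<omega>
             + (1 / real N) *
               (LINT s:{0..t}|lborel. \<Sum>j\<in>{1..N} - {i}. 1 / (X i s \<omega> - X j s \<omega>))))"

(* (1/N) * (sum of the Dirac masses at x 1, ..., x N), as the law of x I for I uniform on 1..N. *)
definition empirical_measure :: "nat \<Rightarrow> (nat \<Rightarrow> real) \<Rightarrow> real measure" where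
  "empirical_measure N x = distr (uniform_count_measure {1..N}) borel x"


(* Topology of C([0,T] -> probability measures): the weak topology is induced by the uniformity of
   the functionals nu |-> (integral of f d nu), f bounded and continuous, so a path is continuous
   iff every such functional is continuous along it, and paths converge (in the compact-open
   topology) iff every such functional converges uniformly on [0,T]. The null set in the almost
   sure convergence does not depend on f. *)
definition continuous_measure_path :: "(real \<Rightarrow> real measure) \<Rightarrow> bool" where
  "continuous_measure_path \<mu> \<longleftrightarrow>
     (\<forall>t\<ge>0. real_distribution (\<mu> t)) \<and>
     (\<forall>f::real \<Rightarrow> real. continuous_on UNIV f \<and> bounded (range f) \<longrightarrow>
        continuous_on {0..} (\<lambda>t. \<integral>x. f x \<partial>\<mu> t))"

definition measure_paths_converge ::
  "real \<Rightarrow> (nat \<Rightarrow> real \<Rightarrow> real measure) \<Rightarrow> (real \<Rightarrow> real measure) \<Rightarrow> bool" where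
  "measure_paths_converge T \<nu> \<mu> \<longleftrightarrow>
     (\<forall>f::real \<Rightarrow> real. continuous_on UNIV f \<and> bounded (range f) \<longrightarrow>
        uniform_limit {0..T} (\<lambda>N t. \<integral>x. f x \<partial>\<nu> N t) (\<lambda>t. \<integral>x. f x \<partial>\<mu> t) sequentially)"

definition dyson_hydrodynamic_limit ::
  "'w measure \<Rightarrow> real \<Rightarrow> (nat \<Rightarrow> nat \<Rightarrow> real) \<Rightarrow> (nat \<Rightarrow> nat \<Rightarrow> real \<Rightarrow> 'w \<Rightarrow> real) \<Rightarrow>
   (nat \<Rightarrow> nat \<Rightarrow> real \<Rightarrow> 'w \<Rightarrow> real) \<Rightarrow> (real \<Rightarrow> real measure) \<Rightarrow> bool" where
  "dyson_hydrodynamic_limit M \<beta> x B X \<mu> \<longleftrightarrow>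
     prob_space M \<and>
     (\<forall>N\<ge>1. dyson_model M \<beta> N (x N) (B N) (X N)) \<and>
     bdd_above ((\<lambda>N. (1 / real N) * (\<Sum>i=1..N. ln ((x N i)\<^sup>2 + 1))) ` {1..}) \<and>
     weak_conv_m (\<lambda>N. empirical_measure N (x N)) (\<mu> 0) \<and>
     continuous_measure_path \<mu> \<and>
     (\<forall>T\<ge>0. AE \<omega> in M.
        measure_paths_converge T (\<lambda>N t. empirical_measure N (\<lambda>i. X N i t \<omega>)) \<mu>)"


definition green :: "(real \<Rightarrow> real measure) \<Rightarrow> real \<Rightarrow> complex \<Rightarrow> complex" where
  "green \<mu> t z = (\<integral>x. 1 / (z - complex_of_real x) \<partial>\<mu> t)"

(* At t = 0 the time derivative is one-sided. *)
definition solves_complex_burgers :: "(real \<Rightarrow> complex \<Rightarrow> complex) \<Rightarrow> bool" where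
  "solves_complex_burgers G \<longleftrightarrow>
     (\<forall>t\<ge>0. \<forall>z. Im z \<noteq> 0 \<longrightarrow>
        (\<exists>G\<^sub>t G\<^sub>z. ((\<lambda>s. G s z) has_vector_derivative G\<^sub>t) (at t within {0..}) \<and>
                 (G t has_field_derivative G\<^sub>z) (at z) \<and>
                 G\<^sub>t + G t z * G\<^sub>z = 0))"


definition has_pdf :: "real measure \<Rightarrow> (real \<Rightarrow> real) \<Rightarrow> bool" where
  "has_pdf \<nu> f \<longleftrightarrow>
     f \<in> borel_measurable borel \<and> (\<forall>x. 0 \<le> f x) \<and> \<nu> = density lborel (\<lambda>x. ennreal (f x))"

definition sum_of_point_masses :: "real measure \<Rightarrow> bool" where
  "sum_of_point_masses \<nu> \<longleftrightarrow> (\<exists>A. countable A \<and> (AE x in \<nu>. x \<in> A))"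

(* At t = 0 a sum of point masses is admitted; rho(0,x) dx then stands for mu(0,dx) and the
   value of rho 0 is irrelevant. *)
definition has_density_process ::
  "(real \<Rightarrow> real measure) \<Rightarrow> (real \<Rightarrow> real \<Rightarrow> real) \<Rightarrow> bool" where
  "has_density_process \<mu> \<rho> \<longleftrightarrow>
     (\<forall>t>0. has_pdf (\<mu> t) (\<rho> t)) \<and> (has_pdf (\<mu> 0) (\<rho> 0) \<or> sum_of_point_masses (\<mu> 0))"

(* E is the set of break points (t,x). The pieces make up an open set of (0,oo) x R, and in each
   variable separately the break points are locally finite; those in t may accumulate at t = 0.
   Continuity across E is not required. *)
definition piecewise_differentiable_off ::
  "(real \<times> real) set \<Rightarrow> (real \<Rightarrow> real \<Rightarrow> real) \<Rightarrow> bool" where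
  "piecewise_differentiable_off E \<rho> \<longleftrightarrow>
     closedin (top_of_set ({0<..} \<times> UNIV)) E \<and>
     (\<forall>t>0. \<forall>a b. finite {x \<in> {a..b}. (t, x) \<in> E}) \<and>
     (\<forall>x. \<forall>a>0. \<forall>b. finite {t \<in> {a..b}. (t, x) \<in> E}) \<and>
     (\<forall>t>0. \<forall>x. (t, x) \<notin> E \<longrightarrow>
        (\<lambda>s. \<rho> s x) differentiable (at t) \<and> \<rho> t differentiable (at x))"

(* Piecewise-defined derivatives; the value 0 on the break points is a convention that affects only
   countably many x for each t. *)
definition pw_deriv_t :: "(real \<times> real) set \<Rightarrow> (real \<Rightarrow> real \<Rightarrow> real) \<Rightarrow> real \<Rightarrow> real \<Rightarrow> real" where
  "pw_deriv_t E \<rho> t x = (if (t, x) \<in> E then 0 else deriv (\<lambda>s. \<rho> s x) t)"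

definition pw_deriv_x :: "(real \<times> real) set \<Rightarrow> (real \<Rightarrow> real \<Rightarrow> real) \<Rightarrow> real \<Rightarrow> real \<Rightarrow> real" where
  "pw_deriv_x E \<rho> t x = (if (t, x) \<in> E then 0 else deriv (\<rho> t) x)"

definition in_Lp :: "real \<Rightarrow> (real \<Rightarrow> real) \<Rightarrow> bool" where
  "in_Lp p f \<longleftrightarrow> f \<in> borel_measurable lborel \<and> integrable lborel (\<lambda>x. \<bar>f x\<bar> powr p)"

definition hilbert_transform :: "(real \<Rightarrow> real) \<Rightarrow> real \<Rightarrow> real" where
  "hilbert_transform f x =
     (1 / pi) * Lim (at_right 0)
       (\<lambda>\<epsilon>. (LINT y:{..x - \<epsilon>}|lborel. f y / (x - y)) + (LINT y:{x + \<epsilon>..}|lborel. f y / (x - y)))"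

end

theory Submission
  imports Defs "HOL-Complex_Analysis.Conformal_Mappings"
begin

text \<open>The function \<open>G\<close> is constant along the lines \<open>s \<mapsto> a + s w\<close> with \<open>w = G(s, a + s w)\<close>, by a
  Gronwall argument; followed back to time 0, inside a half-plane, these characteristics give (ii).

  For (i), no boundary regularity of \<open>\<rho>\<close> is needed beyond differentiability off \<open>E\<close>, where
  \<open>G(t, y + i 0) = \<pi> (H \<rho> - i \<rho>)(y)\<close> by Plemelj's formula. If \<open>\<rho>(t, y) > 0\<close>, the point
  \<open>\<zeta> = y - t G(t, y + i 0)\<close> lies in the open upper half-plane, where \<open>G(0, \<cdot>)\<close> is analytic and
  \<open>z \<mapsto> z + t G(0, z)\<close> has nonzero derivative, so that its local inverse extends \<open>G(t, \<cdot>)\<close>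
  analytically across \<open>y\<close>. Inverting \<open>z \<mapsto> (y - z) / G(0, z)\<close> instead describes \<open>\<rho>(s, y)\<close> for
  \<open>s\<close> near \<open>t\<close>. Both derivatives are then explicit, and they agree. If \<open>\<rho>(t, y) = 0\<close>, then
  \<open>\<rho> \<ge> 0\<close> has a minimum there and both terms vanish, because the bound \<open>\<bar>G(t, z)\<bar> \<le> 1 / sqrt t\<close>
  keeps \<open>H \<rho>\<close> bounded.\<close>

section \<open>Stieltjes transforms of probability measures\<close>

text \<open>The Green's function of a single measure, so that estimates at a fixed time can be made
  for an arbitrary probability measure before a path of measures enters.\<close>

definition stieltjes :: "real measure \<Rightarrow> complex \<Rightarrow> complex" where
  "stieltjes \<nu> z = (\<integral>x. 1 / (z - complex_of_real x) \<partial>\<nu>)"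

lemma green_eq_stieltjes: "green \<mu> t z = stieltjes (\<mu> t) z"
  by (simp add: green_def stieltjes_def)

lemma diff_of_real_nonzero: "Im z \<noteq> 0 \<Longrightarrow> z - complex_of_real x \<noteq> 0"
  by (auto simp: complex_eq_iff)

text \<open>Exact second-order Taylor remainder of \<open>1 / w\<close> at \<open>a\<close>. Being
  an identity, it can be integrated against a measure with explicit constants.\<close>

lemma second_difference_inverse:
  fixes a b :: complex
  assumes "a \<noteq> 0" "b \<noteq> 0"
  shows "1 / b - 1 / a + (b - a) * (1 / a\<^sup>2) = (b - a)\<^sup>2 * (1 / a\<^sup>2) * (1 / b)"
proof -
  have "1 / b - 1 / a = (a - b) / (a * b)"
    using assms by (simp add: field_simps)
  then show ?thesis
    using assms by (simp add: field_simps power2_eq_square)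
qed

lemma norm_inverse_power_le:
  assumes "Im z \<noteq> 0"
  shows "norm (1 / (z - complex_of_real x) ^ n) \<le> 1 / \<bar>Im z\<bar> ^ n"
proof -
  have "\<bar>Im z\<bar> \<le> norm (z - complex_of_real x)"
    using abs_Im_le_cmod[of "z - complex_of_real x"] by simp
  then have "\<bar>Im z\<bar> ^ n \<le> norm (z - complex_of_real x) ^ n"
    by (rule power_mono) simp
  then show ?thesis
    using assms diff_of_real_nonzero[OF assms, of x]
    by (auto simp: norm_divide norm_power intro!: divide_left_mono)
qed

context real_distribution
begin

lemma integrable_inverse_power:
  assumes "Im z \<noteq> 0"
  shows "integrable M (\<lambda>x. 1 / (z - complex_of_real x) ^ n)"
proof (rule integrable_const_bound)
  show "AE x in M. norm (1 / (z - complex_of_real x) ^ n) \<le> 1 / \<bar>Im z\<bar> ^ n"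
    using norm_inverse_power_le[OF assms] by simp
qed simp

lemma integrable_inverse_norm_sq:
  assumes "Im z \<noteq> 0"
  shows "integrable M (\<lambda>x. 1 / (norm (z - complex_of_real x))\<^sup>2)"
  using integrable_norm[OF integrable_inverse_power[OF assms, of 2]]
  by (simp add: norm_divide norm_power)

lemma norm_integral_inverse_power_le:
  assumes "Im z \<noteq> 0"
  shows "norm (\<integral>x. 1 / (z - complex_of_real x) ^ n \<partial>M) \<le> 1 / \<bar>Im z\<bar> ^ n"
proof -
  have "norm (\<integral>x. 1 / (z - complex_of_real x) ^ n \<partial>M)
      \<le> (\<integral>x. norm (1 / (z - complex_of_real x) ^ n) \<partial>M)"
    by (rule integral_norm_bound)
  also have "\<dots> \<le> (\<integral>x. 1 / \<bar>Im z\<bar> ^ n \<partial>M)"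
    by (intro integral_mono integrable_norm integrable_inverse_power assms norm_inverse_power_le) simp
  finally show ?thesis using prob_space by simp
qed

lemma stieltjes_cnj: "stieltjes M (cnj z) = cnj (stieltjes M z)"
  unfolding stieltjes_def by (subst Bochner_Integration.integral_cnj[symmetric]) (simp del: Bochner_Integration.integral_cnj)

lemma Im_stieltjes:
  assumes "Im z \<noteq> 0"
  shows "Im (stieltjes M z) = - Im z * (\<integral>x. 1 / (norm (z - complex_of_real x))\<^sup>2 \<partial>M)"
proof -
  have "Im (stieltjes M z) = (\<integral>x. Im (1 / (z - complex_of_real x)) \<partial>M)"
    unfolding stieltjes_def
    using integrable_inverse_power[OF assms, of 1] by (simp add: integral_Im)
  also have "\<dots> = (\<integral>x. - Im z * (1 / (norm (z - complex_of_real x))\<^sup>2) \<partial>M)"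
    by (intro Bochner_Integration.integral_cong refl) (simp add: Im_divide cmod_power2)
  finally show ?thesis by (simp only: integral_mult_right_zero)
qed

lemma Im_stieltjes_nonpos: "Im z > 0 \<Longrightarrow> Im (stieltjes M z) \<le> 0"
  by (simp add: Im_stieltjes integral_nonneg)

text \<open>Integrates the Taylor remainder of the kernel. The bound involves only imaginary parts
  and is the same for every probability measure; besides differentiability in \<open>z\<close>, this
  allows the measure to vary together with the point.\<close>

lemma stieltjes_remainder:
  assumes "Im z \<noteq> 0" "Im z' \<noteq> 0"
  shows "norm (stieltjes M z' - stieltjes M z + (z' - z) * (\<integral>x. 1 / (z - complex_of_real x)\<^sup>2 \<partial>M))
       \<le> (norm (z' - z))\<^sup>2 / ((Im z)\<^sup>2 * \<bar>Im z'\<bar>)"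
proof -
  let ?r = "\<lambda>x. 1 / (z' - complex_of_real x) - 1 / (z - complex_of_real x)
      + (z' - z) * (1 / (z - complex_of_real x)\<^sup>2)"
  have r: "?r x = (z' - z)\<^sup>2 * (1 / (z - complex_of_real x)^2) * (1 / (z' - complex_of_real x) ^ 1)" for x
    using diff_of_real_nonzero[OF assms(1), of x] diff_of_real_nonzero[OF assms(2), of x]
      second_difference_inverse[of "z - complex_of_real x" "z' - complex_of_real x"]
    by simp
  have "stieltjes M z' - stieltjes M z + (z' - z) * (\<integral>x. 1 / (z - complex_of_real x)\<^sup>2 \<partial>M) = (\<integral>x. ?r x \<partial>M)"
    unfolding stieltjes_def
    using integrable_inverse_power[OF assms(1), of 1] integrable_inverse_power[OF assms(2), of 1]
      integrable_inverse_power[OF assms(1), of 2]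
    by (simp del: times_divide_eq_right)
  also have "norm \<dots> \<le> (norm (z' - z))\<^sup>2 / ((Im z)\<^sup>2 * \<bar>Im z'\<bar>)"
  proof -
    have le: "norm (?r x) \<le> (norm (z' - z))\<^sup>2 / ((Im z)\<^sup>2 * \<bar>Im z'\<bar>)" for x
    proof -
      have "norm (?r x) = (norm (z' - z))\<^sup>2 * norm (1 / (z - complex_of_real x)^2) * norm (1 / (z' - complex_of_real x) ^ 1)"
        unfolding r by (simp only: norm_mult norm_power)
      also have "\<dots> \<le> (norm (z' - z))\<^sup>2 * (1 / \<bar>Im z\<bar>^2) * (1 / \<bar>Im z'\<bar>^1)"
        by (intro mult_mono norm_inverse_power_le assms) auto
      finally show ?thesis by simp
    qed
    have int: "integrable M ?r"
      using integrable_inverse_power[OF assms(1), of 1] integrable_inverse_power[OF assms(2), of 1]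
        integrable_inverse_power[OF assms(1), of 2] by (simp del: times_divide_eq_right)
    have "norm (\<integral>x. ?r x \<partial>M) \<le> (\<integral>x. norm (?r x) \<partial>M)"
      by (rule integral_norm_bound)
    also have "\<dots> \<le> (\<integral>x. (norm (z' - z))\<^sup>2 / ((Im z)\<^sup>2 * \<bar>Im z'\<bar>) \<partial>M)"
      by (intro integral_mono integrable_norm int le) simp
    finally show ?thesis using prob_space by simp
  qed
  finally show ?thesis .
qed

lemma stieltjes_has_field_derivative:
  assumes "Im z \<noteq> 0"
  shows "(stieltjes M has_field_derivative - (\<integral>x. 1 / (z - complex_of_real x)\<^sup>2 \<partial>M)) (at z)"
proof -
  define S where "S = (\<integral>x. 1 / (z - complex_of_real x)\<^sup>2 \<partial>M)"
  have "((\<lambda>z'. norm (z' - z) / ((Im z)\<^sup>2 * \<bar>Im z'\<bar>)) \<longlongrightarrow> norm (z - z) / ((Im z)\<^sup>2 * \<bar>Im z\<bar>)) (at z)"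
    by (intro tendsto_intros) (use assms in auto)
  then have lim: "((\<lambda>z'. norm (z' - z) / ((Im z)\<^sup>2 * \<bar>Im z'\<bar>)) \<longlongrightarrow> 0) (at z)"
    by simp
  have "\<forall>\<^sub>F z' in at z. Im z' \<noteq> 0"
    by (rule tendsto_imp_eventually_ne[OF tendsto_Im[OF tendsto_ident_at] assms])
  then have "\<forall>\<^sub>F z' in at z. norm ((stieltjes M z' - stieltjes M z) / (z' - z) - (- S))
        \<le> norm (z' - z) / ((Im z)\<^sup>2 * \<bar>Im z'\<bar>)"
    using eventually_neq_at_within[of z z UNIV]
  proof eventually_elim
    case (elim z')
    have "(stieltjes M z' - stieltjes M z) / (z' - z) - (- S)
        = (stieltjes M z' - stieltjes M z + (z' - z) * S) / (z' - z)"
      using elim by (simp add: field_simps)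
    then have "norm ((stieltjes M z' - stieltjes M z) / (z' - z) - (- S))
        \<le> ((norm (z' - z))\<^sup>2 / ((Im z)\<^sup>2 * \<bar>Im z'\<bar>)) / norm (z' - z)"
      using divide_right_mono[OF stieltjes_remainder[OF assms elim(1)], of "norm (z' - z)"]
      by (simp add: norm_divide S_def)
    also have "\<dots> = norm (z' - z) / ((Im z)\<^sup>2 * \<bar>Im z'\<bar>)"
      using elim by (simp add: power2_eq_square)
    finally show ?case .
  qed
  then have "((\<lambda>z'. (stieltjes M z' - stieltjes M z) / (z' - z) - (- S)) \<longlongrightarrow> 0) (at z)"
    by (rule Lim_null_comparison) (rule lim)
  then show ?thesis
    unfolding has_field_derivative_iff S_def by (rule LIM_zero_cancel)
qed

lemma stieltjes_holomorphic: "stieltjes M holomorphic_on {z. Im z > 0}"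
proof -
  have "stieltjes M field_differentiable at z" if "Im z > 0" for z
    using stieltjes_has_field_derivative[of z] that unfolding field_differentiable_def by auto
  then show ?thesis
    by (simp add: holomorphic_on_def field_differentiable_at_within)
qed

text \<open>Nonnegativity of the variance of \<open>1 / |z - x|\<close>, that is, the Cauchy-Schwarz
  inequality for a probability measure.\<close>

lemma norm_stieltjes_sq_le:
  assumes "Im z \<noteq> 0"
  shows "(norm (stieltjes M z))\<^sup>2 \<le> (\<integral>x. 1 / (norm (z - complex_of_real x))\<^sup>2 \<partial>M)"
proof -
  let ?h = "\<lambda>x. 1 / norm (z - complex_of_real x)"
  have i1: "integrable M ?h"
    using integrable_norm[OF integrable_inverse_power[OF assms, of 1]] by (simp add: norm_divide)
  have i2: "integrable M (\<lambda>x. (?h x)\<^sup>2)"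
    using integrable_inverse_norm_sq[OF assms] by (simp add: power_divide)
  have "norm (stieltjes M z) \<le> expectation ?h"
    unfolding stieltjes_def
    using integral_norm_bound[of M "\<lambda>x. 1 / (z - complex_of_real x)"] by (simp add: norm_divide)
  then have "(norm (stieltjes M z))\<^sup>2 \<le> (expectation ?h)\<^sup>2"
    by (rule power_mono) simp
  also have "\<dots> \<le> expectation (\<lambda>x. (?h x)\<^sup>2)"
    using variance_positive[of ?h] variance_eq[OF i1 i2] by simp
  finally show ?thesis by (simp add: power_divide)
qed

text \<open>The imaginary part of the hypothesis says \<open>t * \<integral> d\<nu> / \<bar>z - x\<bar>\<^sup>2 = 1\<close>; a vanishing
  derivative would say \<open>t * \<integral> d\<nu> / (z - x)\<^sup>2 = 1\<close>, which forces \<open>z - x\<close> to be real.\<close>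

lemma subordination_derivative_nonzero:
  assumes "Im z > 0" "t > 0" "Im (z + of_real t * stieltjes M z) = 0"
  shows "1 - of_real t * (\<integral>x. 1 / (z - complex_of_real x)\<^sup>2 \<partial>M) \<noteq> 0"
proof
  assume *: "1 - of_real t * (\<integral>x. 1 / (z - complex_of_real x)\<^sup>2 \<partial>M) = 0"
  have z: "Im z \<noteq> 0" using assms by simp
  let ?I = "\<integral>x. 1 / (norm (z - complex_of_real x))\<^sup>2 \<partial>M"
  have "Im z * (1 - t * ?I) = 0"
    using assms(3) by (simp add: Im_stieltjes[OF z] algebra_simps)
  then have I: "t * ?I = 1" using z by simp
  have "Re (\<integral>x. 1 / (z - complex_of_real x)\<^sup>2 \<partial>M) = (\<integral>x. Re (1 / (z - complex_of_real x)\<^sup>2) \<partial>M)"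
    using integrable_inverse_power[OF z, of 2] by (simp add: integral_Re)
  moreover have "t * Re (\<integral>x. 1 / (z - complex_of_real x)\<^sup>2 \<partial>M) = 1"
    using arg_cong[OF *, of Re] by simp
  ultimately have eq: "?I = (\<integral>x. Re (1 / (z - complex_of_real x)\<^sup>2) \<partial>M)"
    using I assms(2) by (metis mult_left_cancel less_irrefl)
  let ?d = "\<lambda>x. 1 / (norm (z - complex_of_real x))\<^sup>2 - Re (1 / (z - complex_of_real x)\<^sup>2)"
  \<comment> \<open>With \<open>w = z - x\<close> the difference equals
    \<open>2 (Im w)^2 / |w|^4\<close>. A strictly positive function cannot have integral 0 against a
    probability measure.\<close>
  have d: "?d x > 0" for x
  proof -
    define w where "w = z - complex_of_real x"
    have w: "Im w > 0" using assms by (simp add: w_def)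
    have n: "(norm w)\<^sup>2 = (Re w)\<^sup>2 + (Im w)\<^sup>2" by (rule cmod_power2)
    have pos: "(Re w)\<^sup>2 + (Im w)\<^sup>2 > 0" using w by (simp add: sum_power2_gt_zero_iff)
    have "Re (1 / w\<^sup>2) = ((Re w)\<^sup>2 - (Im w)\<^sup>2) / ((Re w)\<^sup>2 + (Im w)\<^sup>2)\<^sup>2"
      by (simp add: Re_divide power2_eq_square algebra_simps)
    also have "\<dots> < ((Re w)\<^sup>2 + (Im w)\<^sup>2) / ((Re w)\<^sup>2 + (Im w)\<^sup>2)\<^sup>2"
      using w pos by (intro divide_strict_right_mono) auto
    also have "\<dots> = 1 / (norm w)\<^sup>2" using pos n by (simp add: power2_eq_square)
    finally show ?thesis by (simp add: w_def)
  qed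
  have int: "integrable M ?d"
    using integrable_inverse_norm_sq[OF z] integrable_inverse_power[OF z, of 2]
    by (intro Bochner_Integration.integrable_diff integrable_Re)
  have "(\<integral>x. ?d x \<partial>M) = 0"
    using eq integrable_inverse_norm_sq[OF z] integrable_inverse_power[OF z, of 2]
    by (subst Bochner_Integration.integral_diff) (auto intro!: integrable_Re)
  then have "AE x in M. ?d x = 0"
    using integral_nonneg_eq_0_iff_AE[OF int] d by (simp add: less_imp_le)
  then have "AE x in M. False"
  proof eventually_elim
    case (elim x)
    show False using elim d[of x] by linarith
  qed
  then show False by simp
qed

end

section \<open>Characteristics of the complex Burgers equation\<close>

text \<open>Gronwall's argument for \<open>u = |f|^2\<close>, which unlike the norm is
  differentiable where \<open>f\<close> vanishes. From \<open>|u'| \<le> 2 K u\<close>, the product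
  \<open>exp (2 K r) * u r\<close> is nondecreasing and \<open>exp (- 2 K r) * u r\<close> is
  nonincreasing, so the zero at \<open>s0\<close> spreads to its left and to its right. Both
  directions are needed, since characteristics are followed backward as well as forward.\<close>

lemma zero_if_derivative_bounded:
  fixes f f' :: "real \<Rightarrow> 'a::real_inner"
  assumes deriv: "\<And>s. s \<in> {a..b} \<Longrightarrow> (f has_vector_derivative f' s) (at s within {a..b})"
    and bound: "\<And>s. s \<in> {a..b} \<Longrightarrow> norm (f' s) \<le> K * norm (f s)"
    and s0: "s0 \<in> {a..b}" "f s0 = 0" and s: "s \<in> {a..b}"
  shows "f s = 0"
proof -
  define u where "u r = f r \<bullet> f r" for r
  have cont: "continuous_on {a..b} u"
    unfolding u_def using deriv
    by (intro continuous_intros continuous_on_vector_derivative) auto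
  have u_deriv: "(u has_real_derivative 2 * (f r \<bullet> f' r)) (at r)" if "a < r" "r < b" for r
  proof -
    have "(f has_derivative (\<lambda>h. h *\<^sub>R f' r)) (at r)"
      using deriv[of r] that by (simp add: has_vector_derivative_def at_within_Icc_at)
    from has_derivative_inner[OF this this]
    have "(u has_derivative (\<lambda>h. (f r \<bullet> f' r) * h + (f r \<bullet> f' r) * h)) (at r)"
      unfolding u_def by (simp add: inner_commute algebra_simps)
    then show ?thesis
      by (rule has_derivative_imp_has_field_derivative) (simp add: algebra_simps)
  qed
  have u_bound: "\<bar>2 * (f r \<bullet> f' r)\<bar> \<le> 2 * K * u r" if "r \<in> {a..b}" for r
  proof -
    have "\<bar>f r \<bullet> f' r\<bar> \<le> norm (f r) * norm (f' r)" by (rule Cauchy_Schwarz_ineq2)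
    also have "\<dots> \<le> norm (f r) * (K * norm (f r))"
      using bound[OF that] by (rule mult_left_mono) simp
    finally show ?thesis by (simp add: u_def dot_square_norm power2_eq_square ac_simps)
  qed
  have "u s \<le> 0"
  proof (cases "s \<le> s0")
    case True
    have "exp (2 * K * s) * u s \<le> exp (2 * K * s0) * u s0"
    proof (rule DERIV_nonneg_imp_increasing_open[OF True])
      show "continuous_on {s..s0} (\<lambda>r. exp (2 * K * r) * u r)"
        using s0 s by (intro continuous_intros continuous_on_subset[OF cont]) auto
      fix r assume r: "s < r" "r < s0"
      have "((\<lambda>r. exp (2 * K * r) * u r) has_real_derivative
          exp (2 * K * r) * (2 * K * u r + 2 * (f r \<bullet> f' r))) (at r)"
        using s0 s r by (auto intro!: derivative_eq_intros u_deriv simp: algebra_simps)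
      moreover have "0 \<le> exp (2 * K * r) * (2 * K * u r + 2 * (f r \<bullet> f' r))"
        using u_bound[of r] s0 s r by (intro mult_nonneg_nonneg) auto
      ultimately show "\<exists>y. ((\<lambda>r. exp (2 * K * r) * u r) has_real_derivative y) (at r) \<and> 0 \<le> y"
        by blast
    qed
    then show ?thesis using s0 by (simp add: u_def mult_le_0_iff)
  next
    case False
    then have le: "s0 \<le> s" by simp
    have "- exp (- 2 * K * s0) * u s0 \<le> - exp (- 2 * K * s) * u s"
    proof (rule DERIV_nonneg_imp_increasing_open[OF le])
      show "continuous_on {s0..s} (\<lambda>r. - exp (- 2 * K * r) * u r)"
        using s0 s by (intro continuous_intros continuous_on_subset[OF cont]) auto
      fix r assume r: "s0 < r" "r < s"
      have "((\<lambda>r. - exp (- 2 * K * r) * u r) has_real_derivative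
          exp (- 2 * K * r) * (2 * K * u r - 2 * (f r \<bullet> f' r))) (at r)"
        using s0 s r by (auto intro!: derivative_eq_intros u_deriv simp: algebra_simps)
      moreover have "0 \<le> exp (- 2 * K * r) * (2 * K * u r - 2 * (f r \<bullet> f' r))"
        using u_bound[of r] s0 s r by (intro mult_nonneg_nonneg) auto
      ultimately show "\<exists>y. ((\<lambda>r. - exp (- 2 * K * r) * u r) has_real_derivative y) (at r) \<and> 0 \<le> y"
        by blast
    qed
    then show ?thesis using s0 by (simp add: u_def mult_le_0_iff)
  qed
  then show ?thesis
    using inner_ge_zero[of "f s"] inner_eq_zero_iff[of "f s"] unfolding u_def by (metis order_antisym)
qed

lemma has_vector_derivative_within_iff:
  "(f has_vector_derivative D) (at x within S) \<longleftrightarrow>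
     ((\<lambda>y. (f y - f x) /\<^sub>R (y - x)) \<longlongrightarrow> D) (at x within S)"
proof -
  have "\<forall>\<^sub>F y in at x within S. norm ((1 / norm (y - x)) *\<^sub>R (f y - (f x + (y - x) *\<^sub>R D)))
      = norm ((f y - f x) /\<^sub>R (y - x) - D)"
    unfolding eventually_at_filter
  proof (intro always_eventually allI impI)
    fix y assume "y \<noteq> x"
    then have "(f y - f x) /\<^sub>R (y - x) - D = (1 / (y - x)) *\<^sub>R (f y - (f x + (y - x) *\<^sub>R D))"
      by (simp add: scaleR_right_diff_distrib scaleR_right_distrib divide_inverse)
    then show "norm ((1 / norm (y - x)) *\<^sub>R (f y - (f x + (y - x) *\<^sub>R D)))
      = norm ((f y - f x) /\<^sub>R (y - x) - D)" by simp
  qed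
  then have "((\<lambda>y. norm ((1 / norm (y - x)) *\<^sub>R (f y - (f x + (y - x) *\<^sub>R D)))) \<longlongrightarrow> 0) (at x within S)
      \<longleftrightarrow> ((\<lambda>y. norm ((f y - f x) /\<^sub>R (y - x) - D)) \<longlongrightarrow> 0) (at x within S)"
    by (rule tendsto_cong)
  then show ?thesis
    unfolding has_vector_derivative_def has_derivative_within tendsto_norm_zero_iff LIM_zero_iff
    using bounded_linear_scaleR_left by blast
qed

locale burgers_flow =
  fixes \<mu> :: "real \<Rightarrow> real measure"
  assumes path: "continuous_measure_path \<mu>"
    and burgers: "solves_complex_burgers (green \<mu>)"
begin

abbreviation G :: "real \<Rightarrow> complex \<Rightarrow> complex" where "G \<equiv> green \<mu>"

lemma real_distribution: "t \<ge> 0 \<Longrightarrow> real_distribution (\<mu> t)"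
  using path by (simp add: continuous_measure_path_def)

text \<open>Weak continuity of the path speaks of real test functions only, so it is applied to the
  real and imaginary parts, which are bounded and continuous because \<open>z\<close> is off the
  real axis.\<close>

lemma continuous_on_integral_inverse_sq:
  assumes "Im z \<noteq> 0"
  shows "continuous_on {0..} (\<lambda>t. \<integral>x. 1 / (z - complex_of_real x)\<^sup>2 \<partial>\<mu> t)"
proof -
  let ?f = "\<lambda>x. 1 / (z - complex_of_real x)\<^sup>2"
  have cont: "continuous_on UNIV ?f"
    by (intro continuous_intros) (use diff_of_real_nonzero[OF assms] in auto)
  have "bounded (range ?f)"
    unfolding bounded_iff using norm_inverse_power_le[OF assms, of _ 2] by blast
  from bounded_linear_image[OF this bounded_linear_Re] bounded_linear_image[OF this bounded_linear_Im]
  have b: "bounded (range (\<lambda>x. Re (?f x)))" "bounded (range (\<lambda>x. Im (?f x)))"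
    by (simp_all only: image_image)
  have "continuous_on {0..} (\<lambda>t. Complex (\<integral>x. Re (?f x) \<partial>\<mu> t) (\<integral>x. Im (?f x) \<partial>\<mu> t))"
    using path b continuous_on_Re[OF cont] continuous_on_Im[OF cont]
    unfolding continuous_measure_path_def
    by (intro continuous_on_Complex) blast+
  moreover have "Complex (\<integral>x. Re (?f x) \<partial>\<mu> t) (\<integral>x. Im (?f x) \<partial>\<mu> t) = (\<integral>x. ?f x \<partial>\<mu> t)" if "t \<in> {0..}" for t
    using real_distribution.integrable_inverse_power[OF real_distribution assms, of t 2] that
    by (simp add: complex_eq_iff)
  ultimately show ?thesis by (rule continuous_on_eq)
qed

text \<open>The Burgers equation supplies separate derivatives in time and space, which alone would
  not give a chain rule. It is recovered by expanding in space at the moving time \<open>r\<close>,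
  with a remainder uniform in the measure. With \<open>Q\<close> the integral, the space derivative
  is \<open>- Q\<close> and the time derivative is \<open>G Q\<close>, so along velocity
  \<open>w\<close> the derivative is \<open>(G - w) Q\<close>.\<close>

lemma green_derivative_along_line:
  fixes a w :: complex
  defines "z \<equiv> \<lambda>r. a + complex_of_real r * w"
  assumes "s \<ge> 0" "Im (z s) \<noteq> 0"
  shows "((\<lambda>r. G r (z r)) has_vector_derivative
           (G s (z s) - w) * (\<integral>x. 1 / (z s - complex_of_real x)\<^sup>2 \<partial>\<mu> s)) (at s within {0..})"
proof -
  define Q where "Q r = (\<integral>x. 1 / (z s - complex_of_real x)\<^sup>2 \<partial>\<mu> r)" for r
  interpret s: real_distribution "\<mu> s" using assms by (intro real_distribution)
  from burgers assms obtain Gt Gz where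
    Gt: "((\<lambda>r. G r (z s)) has_vector_derivative Gt) (at s within {0..})" and
    Gz: "(G s has_field_derivative Gz) (at (z s))" and eq: "Gt + G s (z s) * Gz = 0"
    unfolding solves_complex_burgers_def by meson
  have "(G s has_field_derivative - Q s) (at (z s))"
    using s.stieltjes_has_field_derivative[OF assms(3)] unfolding Q_def green_eq_stieltjes[abs_def]
    by simp
  with Gz have "Gz = - Q s" by (rule DERIV_unique)
  with eq have Gt_eq: "Gt = G s (z s) * Q s" by (simp add: algebra_simps eq_neg_iff_add_eq_0)
  \<comment> \<open>The space increment at time \<open>r\<close> minus its linear part. It is
    quadratic in \<open>r - s\<close>, hence negligible in the difference quotient, and continuity
    of \<open>Q\<close> in time then turns the linear part into \<open>- w * Q s\<close>.\<close>
  define R where "R r = G r (z r) - G r (z s) + (z r - z s) * Q r" for r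
  have z_diff: "z r - z s = complex_of_real (r - s) * w" for r by (simp add: z_def algebra_simps)
  have z_lim: "(z \<longlongrightarrow> z s) (at s within {0..})"
    unfolding z_def by (intro tendsto_intros)
  have "(Q \<longlongrightarrow> Q s) (at s within {0..})"
    using continuous_on_integral_inverse_sq[OF assms(3)] assms(2)
    unfolding continuous_on_def Q_def by auto
  moreover have "((\<lambda>r. (G r (z s) - G s (z s)) /\<^sub>R (r - s)) \<longlongrightarrow> Gt) (at s within {0..})"
    using Gt by (simp add: has_vector_derivative_within_iff)
  moreover have "((\<lambda>r. R r /\<^sub>R (r - s)) \<longlongrightarrow> 0) (at s within {0..})"
  proof (rule Lim_null_comparison)
    have "\<forall>\<^sub>F r in at s within {0..}. Im (z r) \<noteq> 0"
      by (rule tendsto_imp_eventually_ne[OF tendsto_Im[OF z_lim] assms(3)])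
    moreover have "\<forall>\<^sub>F r in at s within {0..}. r \<noteq> s \<and> r \<ge> 0"
      by (auto simp: eventually_at_filter)
    ultimately show "\<forall>\<^sub>F r in at s within {0..}. norm (R r /\<^sub>R (r - s))
        \<le> \<bar>r - s\<bar> * (norm w)\<^sup>2 / ((Im (z s))\<^sup>2 * \<bar>Im (z r)\<bar>)"
    proof eventually_elim
      case (elim r)
      interpret r: real_distribution "\<mu> r" using elim by (intro real_distribution) auto
      have "norm (R r) \<le> (norm (z r - z s))\<^sup>2 / ((Im (z s))\<^sup>2 * \<bar>Im (z r)\<bar>)"
        unfolding R_def Q_def green_eq_stieltjes
        using elim assms by (intro r.stieltjes_remainder) auto
      also have "(norm (z r - z s))\<^sup>2 = \<bar>r - s\<bar> * (\<bar>r - s\<bar> * (norm w)\<^sup>2)"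
        unfolding z_diff norm_mult norm_of_real by (simp add: power2_eq_square algebra_simps)
      finally have "norm (R r) \<le> \<bar>r - s\<bar> * (\<bar>r - s\<bar> * (norm w)\<^sup>2 / ((Im (z s))\<^sup>2 * \<bar>Im (z r)\<bar>))"
        by (simp only: times_divide_eq_right)
      then have "norm (R r) / \<bar>r - s\<bar> \<le> \<bar>r - s\<bar> * (norm w)\<^sup>2 / ((Im (z s))\<^sup>2 * \<bar>Im (z r)\<bar>)"
        using elim by (subst pos_divide_le_eq) (simp_all only: mult.commute zero_less_abs_iff right_minus_eq not_False_eq_True)
      then show ?case by (simp only: norm_scaleR norm_inverse real_norm_def divide_inverse mult.commute abs_inverse)
    qed
    have "((\<lambda>r. \<bar>r - s\<bar> * (norm w)\<^sup>2 / ((Im (z s))\<^sup>2 * \<bar>Im (z r)\<bar>)) \<longlongrightarrow>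
       \<bar>s - s\<bar> * (norm w)\<^sup>2 / ((Im (z s))\<^sup>2 * \<bar>Im (z s)\<bar>)) (at s within {0..})"
      using assms(3) by (intro tendsto_intros z_lim) auto
    then show "((\<lambda>r. \<bar>r - s\<bar> * (norm w)\<^sup>2 / ((Im (z s))\<^sup>2 * \<bar>Im (z r)\<bar>)) \<longlongrightarrow> 0) (at s within {0..})"
      by simp
  qed
  ultimately have "((\<lambda>r. R r /\<^sub>R (r - s) - w * Q r + (G r (z s) - G s (z s)) /\<^sub>R (r - s))
      \<longlongrightarrow> 0 - w * Q s + Gt) (at s within {0..})"
    by (intro tendsto_intros)
  moreover have "0 - w * Q s + Gt = (G s (z s) - w) * Q s"
    by (simp add: Gt_eq algebra_simps)
  moreover have "\<forall>\<^sub>F r in at s within {0..}.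
      R r /\<^sub>R (r - s) - w * Q r + (G r (z s) - G s (z s)) /\<^sub>R (r - s) = (G r (z r) - G s (z s)) /\<^sub>R (r - s)"
    unfolding eventually_at_filter
  proof (intro always_eventually allI impI)
    fix r assume "r \<noteq> s"
    then have d: "complex_of_real (r - s) \<noteq> 0" by simp
    have div: "v /\<^sub>R (r - s) = v / complex_of_real (r - s)" for v :: complex
      by (simp add: scaleR_conv_of_real divide_inverse mult.commute)
    show "R r /\<^sub>R (r - s) - w * Q r + (G r (z s) - G s (z s)) /\<^sub>R (r - s) = (G r (z r) - G s (z s)) /\<^sub>R (r - s)"
      unfolding div R_def z_diff using d
      by (simp del: of_real_diff add: add_divide_distrib diff_divide_distrib)
  qed
  ultimately show ?thesis
    unfolding has_vector_derivative_within_iff Q_def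
    by (auto elim: Lim_transform_eventually)
qed

text \<open>Along the line, \<open>G - w\<close> solves a linear homogeneous equation with
  coefficient \<open>Q\<close>, so one zero, at any time \<open>s0\<close> of the interval, makes it
  vanish identically.\<close>

lemma green_constant_along_characteristic:
  assumes t: "0 \<le> t" and Im: "Im a > 0" "Im (a + complex_of_real t * w) > 0"
    and s0: "s0 \<in> {0..t}" "G s0 (a + complex_of_real s0 * w) = w" and s: "s \<in> {0..t}"
  shows "G s (a + complex_of_real s * w) = w"
proof -
  let ?z = "\<lambda>r. a + complex_of_real r * w"
  let ?Q = "\<lambda>r. \<integral>x. 1 / (?z r - complex_of_real x)\<^sup>2 \<partial>\<mu> r"
  \<comment> \<open>The imaginary part is affine in \<open>r\<close>, hence minimal at an endpoint.
    The line therefore stays at height at least \<open>c\<close>, which bounds the coefficient by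
    \<open>1 / c^2\<close>.\<close>
  define c where "c = min (Im a) (Im (?z t))"
  have c: "c > 0" using Im by (simp add: c_def)
  have c_le: "c \<le> Im (?z r)" if "r \<in> {0..t}" for r
  proof (cases "Im w \<ge> 0")
    case True
    then show ?thesis using that by (simp add: c_def min_le_iff_disj)
  next
    case False
    then have "t * Im w \<le> r * Im w" using that by (intro mult_right_mono_neg) auto
    then show ?thesis by (simp add: c_def min_le_iff_disj)
  qed
  have "G s (?z s) - w = 0"
  proof (rule zero_if_derivative_bounded[where f' = "\<lambda>r. (G r (?z r) - w) * ?Q r"])
    show "s0 \<in> {0..t}" "s \<in> {0..t}" "G s0 (?z s0) - w = 0" using s0 s by auto
    fix r assume r: "r \<in> {0..t}"
    then have nz: "Im (?z r) \<noteq> 0" and r0: "r \<ge> 0" using c_le[OF r] c by auto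
    show "((\<lambda>r. G r (?z r) - w) has_vector_derivative (G r (?z r) - w) * ?Q r) (at r within {0..t})"
      using has_vector_derivative_within_subset[OF green_derivative_along_line[OF r0 nz], of "{0..t}"]
      by (auto intro!: derivative_eq_intros)
    have "norm (?Q r) \<le> 1 / \<bar>Im (?z r)\<bar>\<^sup>2"
      by (rule real_distribution.norm_integral_inverse_power_le[OF real_distribution[OF r0] nz])
    also have "\<dots> \<le> 1 / c\<^sup>2"
      using c c_le[OF r] by (intro divide_left_mono) (auto intro!: power_mono)
    finally show "norm ((G r (?z r) - w) * ?Q r) \<le> 1 / c\<^sup>2 * norm (G r (?z r) - w)"
      unfolding norm_mult by (subst mult.commute) (rule mult_right_mono, simp_all)
  qed
  then show ?thesis by simp
qed

section \<open>The functional equation and a uniform bound on the Green's function\<close>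

lemma Im_green_nonpos: "t \<ge> 0 \<Longrightarrow> Im z > 0 \<Longrightarrow> Im (G t z) \<le> 0"
  unfolding green_eq_stieltjes by (rule real_distribution.Im_stieltjes_nonpos[OF real_distribution])

text \<open>Followed backward in time, a characteristic moves away from the real axis, so it never
  leaves the upper half-plane.\<close>

lemma Im_subordination:
  assumes "t \<ge> 0" "Im z > 0"
  shows "Im (z - complex_of_real t * G t z) \<ge> Im z"
  using Im_green_nonpos[OF assms] assms by (simp add: mult_nonneg_nonpos)

text \<open>The line with velocity \<open>G t z\<close> through \<open>z\<close> at time
  \<open>t\<close> is a characteristic by construction; it is traced from \<open>s0 = t\<close> back
  to time 0.\<close>

lemma green_subordination:
  assumes "t \<ge> 0" "Im z > 0"
  shows "G t z = G 0 (z - complex_of_real t * G t z)"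
  using green_constant_along_characteristic[of t "z - complex_of_real t * G t z" "G t z" t 0]
    Im_subordination[OF assms] assms by simp

text \<open>The lower half-plane is reduced to the upper one by conjugation, as the measures live on
  the real line.\<close>

lemma green_functional_equation:
  assumes "t \<ge> 0" "Im z \<noteq> 0"
  shows "G t z = G 0 (z - complex_of_real t * G t z)"
proof (cases "Im z > 0")
  case True
  then show ?thesis using green_subordination assms by blast
next
  case False
  have cnj: "G s (cnj v) = cnj (G s v)" if "s \<ge> 0" for s v
    unfolding green_eq_stieltjes by (rule real_distribution.stieltjes_cnj[OF real_distribution[OF that]])
  have "G t (cnj z) = G 0 (cnj z - complex_of_real t * G t (cnj z))"
    using green_subordination[of t "cnj z"] assms False by simp
  then have "cnj (G t z) = G 0 (cnj (z - complex_of_real t * G t z))"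
    using assms by (simp add: cnj)
  then have "cnj (G t z) = cnj (G 0 (z - complex_of_real t * G t z))"
    by (simp only: cnj order_refl)
  then show ?thesis by simp
qed

text \<open>The same line started at time 0. Forward characteristics descend towards the real axis,
  so the position of the endpoint is a hypothesis here.\<close>

lemma green_forward_characteristic:
  assumes "t \<ge> 0" "Im \<zeta> > 0" "Im (\<zeta> + complex_of_real t * G 0 \<zeta>) > 0"
  shows "G t (\<zeta> + complex_of_real t * G 0 \<zeta>) = G 0 \<zeta>"
  using green_constant_along_characteristic[of t \<zeta> "G 0 \<zeta>" 0 t] assms by simp

text \<open>With \<zeta> the starting point of the characteristic and \<open>I\<close> the integral
  of \<open>1 / |\<zeta> - x|^2\<close> against the initial measure,
  \<open>Im z = Im \<zeta> * (1 - t I)\<close>. Positivity of both imaginary parts forces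
  \<open>t I < 1\<close>, and \<open>|G|^2 \<le> I\<close>.\<close>

lemma norm_green_le:
  assumes "t > 0" "Im z > 0"
  shows "norm (G t z) \<le> 1 / sqrt t"
proof -
  interpret real_distribution "\<mu> 0" by (rule real_distribution) simp
  define \<zeta> where "\<zeta> = z - complex_of_real t * G t z"
  have \<zeta>: "Im \<zeta> > 0" using Im_subordination[of t z] assms by (simp add: \<zeta>_def)
  let ?I = "\<integral>x. 1 / (norm (\<zeta> - complex_of_real x))\<^sup>2 \<partial>\<mu> 0"
  have G: "G t z = stieltjes (\<mu> 0) \<zeta>"
    using green_subordination[of t z] assms by (simp add: \<zeta>_def green_eq_stieltjes)
  have "Im z = Im \<zeta> + t * Im (G t z)" by (simp add: \<zeta>_def)
  also have "\<dots> = Im \<zeta> * (1 - t * ?I)"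
    using \<zeta> by (simp add: G Im_stieltjes algebra_simps)
  finally have "1 - t * ?I > 0" using assms(2) \<zeta> by (simp add: zero_less_mult_iff)
  then have "?I \<le> 1 / t" using assms(1) by (simp add: field_simps)
  moreover have "(norm (G t z))\<^sup>2 \<le> ?I" unfolding G using \<zeta> by (intro norm_stieltjes_sq_le) simp
  ultimately have "(norm (G t z))\<^sup>2 \<le> 1 / t" by simp
  then have "norm (G t z) \<le> sqrt (1 / t)" by (rule real_le_rsqrt)
  then show ?thesis by (simp add: real_sqrt_divide)
qed

end

section \<open>Extension across the real line\<close>

text \<open>The inverse function theorem with the derivative made explicit. It is applied once to
  invert in the space variable and once in the time variable.\<close>

lemma holomorphic_local_inverse:
  assumes hol: "f holomorphic_on S" and "open S" "\<zeta> \<in> S"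
    and deriv: "(f has_field_derivative d) (at \<zeta>)" and "d \<noteq> 0"
  obtains g T where "open T" "f \<zeta> \<in> T" "g holomorphic_on T" "g (f \<zeta>) = \<zeta>"
    "(g has_field_derivative 1 / d) (at (f \<zeta>))" "\<And>w. w \<in> T \<Longrightarrow> g w \<in> S \<and> f (g w) = w"
proof -
  have d: "deriv f \<zeta> = d" using deriv by (rule DERIV_imp_deriv)
  then obtain r where r: "r > 0" "ball \<zeta> r \<subseteq> S" "open (f ` ball \<zeta> r)" "inj_on f (ball \<zeta> r)"
    using has_complex_derivative_locally_invertible[OF hol assms(3,2)] \<open>d \<noteq> 0\<close> by metis
  obtain g where g: "g holomorphic_on (f ` ball \<zeta> r)"
    and g_deriv: "\<And>z. z \<in> ball \<zeta> r \<Longrightarrow> deriv f z * deriv g (f z) = 1"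
    and g_inv: "\<And>z. z \<in> ball \<zeta> r \<Longrightarrow> g (f z) = z"
    using holomorphic_has_inverse[OF holomorphic_on_subset[OF hol r(2)] open_ball r(4)] by metis
  have \<zeta>: "\<zeta> \<in> ball \<zeta> r" using r(1) by simp
  have "deriv g (f \<zeta>) = 1 / d"
    using g_deriv[OF \<zeta>] d \<open>d \<noteq> 0\<close> by (simp add: divide_simps mult.commute)
  then have "(g has_field_derivative 1 / d) (at (f \<zeta>))"
    using holomorphic_derivI[OF g r(3) imageI[OF \<zeta>]] by simp
  then show ?thesis
  proof (rule that[OF r(3) imageI[OF \<zeta>] g g_inv[OF \<zeta>]])
    fix w assume "w \<in> f ` ball \<zeta> r"
    then obtain z where "z \<in> ball \<zeta> r" "w = f z" by blast
    then show "g w \<in> S \<and> f (g w) = w" using g_inv r(2) by auto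
  qed
qed

context burgers_flow
begin

lemma green_0_has_field_derivative:
  assumes "Im z > 0"
  shows "(G 0 has_field_derivative deriv (G 0) z) (at z)"
    and "deriv (G 0) z = - (\<integral>x. 1 / (z - complex_of_real x)\<^sup>2 \<partial>\<mu> 0)"
proof -
  interpret real_distribution "\<mu> 0" by (rule real_distribution) simp
  have *: "(G 0 has_field_derivative - (\<integral>x. 1 / (z - complex_of_real x)\<^sup>2 \<partial>\<mu> 0)) (at z)"
    unfolding green_eq_stieltjes[abs_def] using assms by (intro stieltjes_has_field_derivative) simp
  show "deriv (G 0) z = - (\<integral>x. 1 / (z - complex_of_real x)\<^sup>2 \<partial>\<mu> 0)"
    by (rule DERIV_imp_deriv[OF *])
  with * show "(G 0 has_field_derivative deriv (G 0) z) (at z)" by simp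
qed

lemma green_0_holomorphic: "G 0 holomorphic_on {z. Im z > 0}"
  unfolding green_eq_stieltjes[abs_def]
  by (rule real_distribution.stieltjes_holomorphic[OF real_distribution]) simp

text \<open>Since the endpoint \<open>y\<close> is real, the map \<open>\<Phi>\<close> has nonzero
  derivative at \<zeta> and a local inverse \<open>g\<close> with values in the upper half-plane. At
  points above the real axis near \<open>y\<close>, the forward characteristic from
  \<open>g w\<close> ends at \<open>w\<close>, so \<open>G t w = G 0 (g w)\<close>; the right-hand
  side is analytic across \<open>y\<close>.\<close>

lemma green_boundary_extension:
  fixes \<zeta> :: complex
  assumes t: "t > 0" and \<zeta>: "Im \<zeta> > 0" and y: "\<zeta> + complex_of_real t * G 0 \<zeta> = complex_of_real y"
  obtains g \<delta> where "\<delta> > 0" "g (complex_of_real y) = \<zeta>"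
    "1 + complex_of_real t * deriv (G 0) \<zeta> \<noteq> 0"
    "(g has_field_derivative 1 / (1 + complex_of_real t * deriv (G 0) \<zeta>)) (at (complex_of_real y))"
    "\<And>u. \<bar>u - y\<bar> < \<delta> \<Longrightarrow>
       ((\<lambda>e. G t (Complex u e)) \<longlongrightarrow> G 0 (g (complex_of_real u))) (at_right 0)"
proof -
  interpret real_distribution "\<mu> 0" by (rule real_distribution) simp
  define \<Phi> where "\<Phi> z = z + complex_of_real t * G 0 z" for z
  define d where "d = 1 + complex_of_real t * deriv (G 0) \<zeta>"
  let ?H = "{z. Im z > 0}"
  have hol: "\<Phi> holomorphic_on ?H"
    unfolding \<Phi>_def by (intro holomorphic_intros green_0_holomorphic)
  have \<Phi>_deriv: "(\<Phi> has_field_derivative d) (at \<zeta>)"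
    unfolding \<Phi>_def d_def by (auto intro!: derivative_eq_intros green_0_has_field_derivative \<zeta>)
  have nz: "d \<noteq> 0"
    using subordination_derivative_nonzero[OF \<zeta> t] arg_cong[OF y, of Im]
    unfolding d_def green_0_has_field_derivative(2)[OF \<zeta>] by (simp add: green_eq_stieltjes)
  have \<Phi>\<zeta>: "\<Phi> \<zeta> = complex_of_real y" using y by (simp add: \<Phi>_def)
  obtain g T where T: "open T" "complex_of_real y \<in> T"
    and g: "g holomorphic_on T" "g (complex_of_real y) = \<zeta>"
      "(g has_field_derivative 1 / d) (at (complex_of_real y))"
    and g_inv: "\<And>w. w \<in> T \<Longrightarrow> g w \<in> ?H \<and> \<Phi> (g w) = w"
    using holomorphic_local_inverse[OF hol open_halfspace_Im_gt _ \<Phi>_deriv nz, unfolded \<Phi>\<zeta>] \<zeta>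
    by (metis (no_types, lifting) mem_Collect_eq)
  obtain \<delta> where \<delta>: "\<delta> > 0" "ball (complex_of_real y) \<delta> \<subseteq> T"
    using T open_contains_ball by blast
  show ?thesis
  proof (rule that[of \<delta> g, folded d_def])
    fix u assume u: "\<bar>u - y\<bar> < \<delta>"
    then have "complex_of_real u \<in> ball (complex_of_real y) \<delta>"
      by (simp add: dist_of_real dist_real_def abs_minus_commute)
    then have uin: "complex_of_real u \<in> T" using \<delta>(2) by blast
    have "Im (g (complex_of_real u)) > 0"
      using uin g_inv by auto
    then have cont_G: "isCont (G 0) (g (complex_of_real u))"
      using green_0_has_field_derivative(1) DERIV_isCont by blast
    have cont_g: "isCont g (complex_of_real u)"
      using holomorphic_derivI[OF g(1) T(1) uin] DERIV_isCont by blast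
    have to_u: "((\<lambda>e. Complex u e) \<longlongrightarrow> complex_of_real u) (at_right 0)"
    proof -
      have "((\<lambda>e. Complex u e) \<longlongrightarrow> Complex u 0) (at_right 0)" by (intro tendsto_intros)
      then show ?thesis by (simp add: complex_of_real_def)
    qed
    have lim: "((\<lambda>e. G 0 (g (Complex u e))) \<longlongrightarrow> G 0 (g (complex_of_real u))) (at_right 0)"
      by (rule isCont_tendsto_compose[OF cont_G isCont_tendsto_compose[OF cont_g to_u]])
    have "\<forall>\<^sub>F e in at_right 0. Complex u e \<in> T"
      by (rule topological_tendstoD[OF to_u T(1) uin])
    moreover have "\<forall>\<^sub>F e in at_right (0::real). e > 0"
      by (rule eventually_at_right_less)
    ultimately have "\<forall>\<^sub>F e in at_right 0. G 0 (g (Complex u e)) = G t (Complex u e)"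
    proof eventually_elim
      case (elim e)
      then have "\<Phi> (g (Complex u e)) = Complex u e" "Im (g (Complex u e)) > 0" using g_inv by auto
      then show ?case
        using green_forward_characteristic[of t "g (Complex u e)"] t elim by (simp add: \<Phi>_def)
    qed
    with lim show "((\<lambda>e. G t (Complex u e)) \<longlongrightarrow> G 0 (g (complex_of_real u))) (at_right 0)"
      by (rule Lim_transform_eventually)
  qed (use \<delta> g nz in auto)
qed

end

section \<open>Plemelj's formula\<close>

text \<open>Reflection about \<open>y\<close> preserves Lebesgue measure, so the integral equals its
  own negative. A non-integrable \<open>f\<close> has integral 0 by default, in agreement with
  this.\<close>

lemma integral_odd_eq_0:
  fixes f :: "real \<Rightarrow> real"
  assumes "\<And>x. f (2 * y - x) = - f x"
  shows "(\<integral>x. f x \<partial>lborel) = 0"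
  using lborel_integral_real_affine[of "-1" f "2 * y"] assms by simp

text \<open>The antiderivative is \<open>arctan ((x - y) / e)\<close>. As \<open>e\<close> tends to
  0 the value tends to pi, the full mass of the kernel.\<close>

lemma integral_Cauchy_kernel:
  assumes "e > 0"
  shows "(\<integral>x. indicator {y - 1..y + 1} x * (e / ((y - x)\<^sup>2 + e\<^sup>2)) \<partial>lborel) = 2 * arctan (1 / e)"
proof -
  have nz: "(y - x)\<^sup>2 + e\<^sup>2 \<noteq> 0" for x :: real using assms by (simp add: sum_power2_eq_zero_iff)
  have "(\<integral>x. (e / ((y - x)\<^sup>2 + e\<^sup>2)) * indicator {y - 1..y + 1} x \<partial>lborel)
      = arctan ((y + 1 - y) / e) - arctan ((y - 1 - y) / e)"
  proof (rule integral_FTC_Icc_real)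
    show "y - 1 \<le> y + 1" by simp
    show "((\<lambda>x. arctan ((x - y) / e)) has_real_derivative e / ((y - x)\<^sup>2 + e\<^sup>2)) (at x)" for x
    proof -
      have "inverse (1 + ((x - y) / e)\<^sup>2) * (1 / e) = e / ((y - x)\<^sup>2 + e\<^sup>2)"
        using assms nz[of x] by (simp add: power_divide field_simps power2_eq_square)
      then show ?thesis using assms by (auto intro!: derivative_eq_intros)
    qed
    show "isCont (\<lambda>x. e / ((y - x)\<^sup>2 + e\<^sup>2)) x" for x
      using nz by (intro continuous_intros) auto
  qed
  then show ?thesis using arctan_minus[of "1 / e"] by (simp add: mult.commute)
qed

text \<open>Subtracting the value \<open>f y\<close> times the indicator of the unit interval around \<open>y\<close>, which is
  even about \<open>y\<close> and so has vanishing principal value, leaves an integrand dominated near \<open>y\<close>.\<close>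

lemma stieltjes_boundary_value:
  assumes pdf: "has_pdf \<nu> f" and \<nu>: "real_distribution \<nu>" and diff: "f differentiable (at y)"
  shows "((\<lambda>e. stieltjes \<nu> (Complex y e)) \<longlongrightarrow>
           complex_of_real pi * Complex (hilbert_transform f y) (- f y)) (at_right 0)"
proof -
  interpret real_distribution \<nu> by fact
  have f_meas [measurable]: "f \<in> borel_measurable borel" and f_nonneg: "\<And>x. 0 \<le> f x"
    and \<nu>_eq: "\<nu> = density lborel (\<lambda>x. ennreal (f x))"
    using pdf by (auto simp: has_pdf_def)
  have "integrable \<nu> (\<lambda>_. 1 :: real)" by simp
  then have f_int: "integrable lborel f"
    unfolding \<nu>_eq using f_nonneg by (subst (asm) integrable_density) auto
  define \<phi> :: "real \<Rightarrow> real" where "\<phi> = indicator {y - 1..y + 1}"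
  define r where "r x = f x - f y * \<phi> x" for x
  have [measurable]: "\<phi> \<in> borel_measurable borel" by (simp add: \<phi>_def)
  have r_meas [measurable]: "r \<in> borel_measurable borel" unfolding r_def by measurable
  have \<phi>_int: "integrable lborel \<phi>" unfolding \<phi>_def by simp
  have r_int: "integrable lborel r"
    unfolding r_def using f_int \<phi>_int by simp
  \<comment> \<open>At \<open>x = y\<close> the quotient \<open>r x / (y - x)\<close> is 0 by the
    convention for division by zero; \<open>r y = 0\<close> makes the regularised quotients vanish
    there too.\<close>
  have ry: "r y = 0" by (simp add: r_def \<phi>_def)
  \<comment> \<open>The common dominating function for the truncated and the regularised
    integrals.\<close>
  define w where "w x = \<bar>r x\<bar> / \<bar>y - x\<bar>" for x
  have w_int: "integrable lborel w"
  proof -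
    obtain D where "(f has_real_derivative D) (at y)"
      using diff by (auto simp: real_differentiable_def)
    then have "((\<lambda>x. (f x - f y) / (x - y)) \<longlongrightarrow> D) (at y)"
      by (simp add: has_field_derivative_iff)
    then have "\<forall>\<^sub>F x in at y. norm ((f x - f y) / (x - y)) < norm D + 1"
      by (intro order_tendstoD(2)[OF tendsto_norm]) auto
    then obtain d where d: "d > 0" "\<And>x. x \<noteq> y \<Longrightarrow> dist x y < d \<Longrightarrow> norm ((f x - f y) / (x - y)) < norm D + 1"
      unfolding eventually_at by auto
    \<comment> \<open>The cap at 1 keeps the neighbourhood inside the interval where \<phi> is 1.
      There \<open>w\<close> is a difference quotient of \<open>f\<close>; outside, the denominator
      is at least \<open>d'\<close>.\<close>
    define d' where "d' = min d 1"
    have d': "d' > 0" using d by (simp add: d'_def)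
    let ?b = "\<lambda>x. (\<bar>D\<bar> + 1) * \<phi> x + \<bar>r x\<bar> / d'"
    show ?thesis
    proof (rule Bochner_Integration.integrable_bound[of _ ?b])
      show "integrable lborel ?b" using \<phi>_int r_int by simp
      show "w \<in> borel_measurable lborel" unfolding w_def by measurable
      show "AE x in lborel. norm (w x) \<le> norm (?b x)"
      proof (intro AE_I2)
        fix x :: real
        have pos: "0 \<le> (\<bar>D\<bar> + 1) * \<phi> x" "0 \<le> \<bar>r x\<bar> / d'" using d' by (auto simp: \<phi>_def)
        have "w x \<le> ?b x"
        proof (cases "\<bar>x - y\<bar> < d'")
          case True
          then have \<phi>1: "\<phi> x = 1" by (auto simp: \<phi>_def d'_def indicator_def)
          show ?thesis
          proof (cases "x = y")
            case False
            then have "w x = norm ((f x - f y) / (x - y))"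
              by (simp add: w_def r_def \<phi>1 abs_divide abs_minus_commute)
            also have "\<dots> \<le> \<bar>D\<bar> + 1"
              using d(2)[OF False] True by (simp add: d'_def dist_real_def)
            finally show ?thesis using pos \<phi>1 by simp
          qed (use pos in \<open>simp add: w_def\<close>)
        next
          case False
          then have "w x \<le> \<bar>r x\<bar> / d'"
            unfolding w_def using d' by (intro divide_left_mono) (auto simp: abs_minus_commute)
          then show ?thesis using pos by simp
        qed
        then show "norm (w x) \<le> norm (?b x)" using pos by (simp add: w_def)
      qed
    qed
  qed
  define I where "I = (\<integral>x. r x / (y - x) \<partial>lborel)"

  let ?A = "\<lambda>e. {..y - e} \<union> {y + e..}"
  \<comment> \<open>After the subtraction the principal value is an absolutely convergent integral.
    Dominated convergence is a statement on sequences, whence the passage to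
    \<open>S\<close>.\<close>
  have pv: "((\<lambda>e. \<integral>x. indicator (?A e) x * (r x / (y - x)) \<partial>lborel) \<longlongrightarrow> I) (at_right 0)"
  proof (rule tendsto_at_right_sequentially[of 0 1])
    fix S :: "nat \<Rightarrow> real" assume S: "\<And>n. 0 < S n" "S \<longlonglongrightarrow> 0"
    show "(\<lambda>n. \<integral>x. indicator (?A (S n)) x * (r x / (y - x)) \<partial>lborel) \<longlonglongrightarrow> I"
      unfolding I_def
    proof (rule integral_dominated_convergence[OF _ _ w_int])
      show "AE x in lborel. (\<lambda>n. indicator (?A (S n)) x * (r x / (y - x))) \<longlonglongrightarrow> r x / (y - x)"
      proof (intro AE_I2)
        fix x :: real
        show "(\<lambda>n. indicator (?A (S n)) x * (r x / (y - x))) \<longlonglongrightarrow> r x / (y - x)"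
        proof (cases "x = y")
          case False
          then have "\<forall>\<^sub>F n in sequentially. S n < \<bar>x - y\<bar>"
            by (intro order_tendstoD(2)[OF S(2)]) simp
          then have "\<forall>\<^sub>F n in sequentially. r x / (y - x) = indicator (?A (S n)) x * (r x / (y - x))"
            by eventually_elim (auto simp: indicator_def)
          then show ?thesis by (rule Lim_transform_eventually[OF tendsto_const])
        qed simp
      qed
      show "AE x in lborel. norm (indicator (?A (S n)) x * (r x / (y - x))) \<le> w x" for n
        by (intro AE_I2) (auto simp: w_def indicator_def abs_divide)
    qed measurable
  qed simp
  \<comment> \<open>At each fixed truncation the part carrying \<phi> is odd about \<open>y\<close>
    and integrates to 0, so \<open>f\<close> may be replaced by \<open>r\<close>.\<close>
  have "\<forall>\<^sub>F e in at_right 0. (\<integral>x. indicator (?A e) x * (r x / (y - x)) \<partial>lborel)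
      = (LINT x:{..y - e}|lborel. f x / (y - x)) + (LINT x:{y + e..}|lborel. f x / (y - x))"
    using eventually_at_right_less[of 0]
  proof eventually_elim
    case (elim e)
    have bound: "\<bar>indicator (?A e) x * (v / (y - x))\<bar> \<le> \<bar>v / e\<bar>" for x v
      using elim by (auto simp: indicator_def abs_divide intro!: divide_left_mono)
    have int: "integrable lborel (\<lambda>x. indicator A x * (h x / (y - x)))"
      if "integrable lborel h" and [measurable]: "A \<in> sets borel" and "A \<subseteq> ?A e"
      for h :: "real \<Rightarrow> real" and A
    proof (rule Bochner_Integration.integrable_bound[of _ "\<lambda>x. h x / e"])
      show "AE x in lborel. norm (indicator A x * (h x / (y - x))) \<le> norm (h x / e)"
      proof (intro AE_I2)
        fix x show "norm (indicator A x * (h x / (y - x))) \<le> norm (h x / e)"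
          using bound[of x "h x"] that(3) by (cases "x \<in> A") (auto simp: indicator_def)
      qed
      have [measurable]: "h \<in> borel_measurable borel"
        using borel_measurable_integrable[OF that(1)] by simp
      show "(\<lambda>x. indicator A x * (h x / (y - x))) \<in> borel_measurable lborel"
        by measurable
    qed (use that in simp)
    have disj: "indicator (?A e) x = (indicator {..y - e} x + indicator {y + e..} x :: real)" for x
      using elim by (auto simp: indicator_def)
    have odd: "(\<integral>x. indicator (?A e) x * (\<phi> x / (y - x)) \<partial>lborel) = 0"
      by (rule integral_odd_eq_0[of _ y]) (auto simp: \<phi>_def indicator_def divide_simps)
    have "(LINT x:{..y - e}|lborel. f x / (y - x)) + (LINT x:{y + e..}|lborel. f x / (y - x))
        = (\<integral>x. indicator {..y - e} x * (f x / (y - x)) \<partial>lborel)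
          + (\<integral>x. indicator {y + e..} x * (f x / (y - x)) \<partial>lborel)"
      by (simp add: set_lebesgue_integral_def)
    also have "\<dots> = (\<integral>x. indicator (?A e) x * (f x / (y - x)) \<partial>lborel)"
      unfolding disj distrib_right
      by (rule Bochner_Integration.integral_add[symmetric]) (intro int f_int; auto)+
    also have "\<dots> = (\<integral>x. indicator (?A e) x * (r x / (y - x)) + f y * (indicator (?A e) x * (\<phi> x / (y - x))) \<partial>lborel)"
      by (intro Bochner_Integration.integral_cong refl)
         (simp add: r_def diff_divide_distrib algebra_simps)
    also have "\<dots> = (\<integral>x. indicator (?A e) x * (r x / (y - x)) \<partial>lborel)
        + f y * (\<integral>x. indicator (?A e) x * (\<phi> x / (y - x)) \<partial>lborel)"
      using int[OF r_int, of "?A e"] int[OF \<phi>_int, of "?A e"]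
      by (subst Bochner_Integration.integral_add) (auto simp del: times_divide_eq_right)
    finally show ?case by (simp only: odd mult_zero_right add_0_right)
  qed
  from Lim_transform_eventually[OF pv this]
  have "hilbert_transform f y = 1 / pi * I"
    unfolding hilbert_transform_def by (simp add: tendsto_Lim)
  then have H: "complex_of_real pi * Complex (hilbert_transform f y) (- f y) = Complex I (- pi * f y)"
    by (simp add: complex_eq_iff)

  \<comment> \<open>The function \<open>w\<close> dominates again, because the distance from
    \<open>Complex y e\<close> to \<open>x\<close> is at least \<open>|y - x|\<close>.\<close>
  have reg: "((\<lambda>e. \<integral>x. complex_of_real (r x) / (Complex y e - complex_of_real x) \<partial>lborel) \<longlongrightarrow>
      (\<integral>x. complex_of_real (r x / (y - x)) \<partial>lborel)) (at_right 0)"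
  proof (rule tendsto_at_right_sequentially[of 0 1])
    fix S :: "nat \<Rightarrow> real" assume S: "\<And>n. 0 < S n" "S \<longlonglongrightarrow> 0"
    show "(\<lambda>n. \<integral>x. complex_of_real (r x) / (Complex y (S n) - complex_of_real x) \<partial>lborel)
        \<longlonglongrightarrow> (\<integral>x. complex_of_real (r x / (y - x)) \<partial>lborel)"
    proof (rule integral_dominated_convergence[OF _ _ w_int])
      show "AE x in lborel. (\<lambda>n. complex_of_real (r x) / (Complex y (S n) - complex_of_real x))
          \<longlonglongrightarrow> complex_of_real (r x / (y - x))"
      proof (intro AE_I2)
        fix x :: real
        show "(\<lambda>n. complex_of_real (r x) / (Complex y (S n) - complex_of_real x))
          \<longlonglongrightarrow> complex_of_real (r x / (y - x))"
        proof (cases "x = y")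
          case False
          have "(\<lambda>n. complex_of_real (r x) / (Complex y (S n) - complex_of_real x))
            \<longlonglongrightarrow> complex_of_real (r x) / (Complex y 0 - complex_of_real x)"
            using False by (intro tendsto_intros S(2)) (auto simp: complex_eq_iff)
          moreover have "Complex y 0 - complex_of_real x = complex_of_real (y - x)"
            by (simp add: complex_eq_iff)
          ultimately show ?thesis by simp
        qed (simp add: ry)
      qed
      show "AE x in lborel. norm (complex_of_real (r x) / (Complex y (S n) - complex_of_real x)) \<le> w x" for n
      proof (intro AE_I2)
        fix x :: real
        show "norm (complex_of_real (r x) / (Complex y (S n) - complex_of_real x)) \<le> w x"
        proof (cases "x = y")
          case False
          have "\<bar>y - x\<bar> \<le> norm (Complex y (S n) - complex_of_real x)"
            using abs_Re_le_cmod[of "Complex y (S n) - complex_of_real x"] by simp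
          then show ?thesis
            using False unfolding w_def norm_divide norm_of_real
            by (intro divide_left_mono mult_pos_pos) auto
        qed (simp add: ry w_def)
      qed
      have [measurable]: "(\<lambda>x. complex_of_real (h x)) \<in> borel_measurable borel"
        if "h \<in> borel_measurable borel" for h :: "real \<Rightarrow> real" using that by simp
      show "(\<lambda>x. complex_of_real (r x) / (Complex y (S n) - complex_of_real x)) \<in> borel_measurable lborel" for n
        by measurable
      show "(\<lambda>x. complex_of_real (r x / (y - x))) \<in> borel_measurable lborel"
        by measurable
    qed
  qed simp
  \<comment> \<open>This limit is the origin of the term \<open>- pi * f y\<close> in the boundary
    value.\<close>
  have "((\<lambda>e. arctan (1 / e)) \<longlongrightarrow> pi / 2) (at_right 0)"
    using filterlim_compose[OF tendsto_arctan_at_top filterlim_inverse_at_top_right]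
    by (simp add: inverse_eq_divide)
  then have "((\<lambda>e. Complex 0 (- 2 * arctan (1 / e))) \<longlongrightarrow> Complex 0 (- 2 * (pi / 2))) (at_right 0)"
    by (intro tendsto_intros)
  from tendsto_add[OF reg tendsto_mult[OF tendsto_const this]]
  have "((\<lambda>e. (\<integral>x. complex_of_real (r x) / (Complex y e - complex_of_real x) \<partial>lborel)
      + complex_of_real (f y) * Complex 0 (- 2 * arctan (1 / e))) \<longlongrightarrow>
      (\<integral>x. complex_of_real (r x / (y - x)) \<partial>lborel) + complex_of_real (f y) * Complex 0 (- 2 * (pi / 2))) (at_right 0)" .
  moreover have "(\<integral>x. complex_of_real (r x / (y - x)) \<partial>lborel) + complex_of_real (f y) * Complex 0 (- 2 * (pi / 2))
      = Complex I (- pi * f y)"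
    unfolding I_def integral_complex_of_real by (simp add: complex_eq_iff)
  moreover have "\<forall>\<^sub>F e in at_right 0. (\<integral>x. complex_of_real (r x) / (Complex y e - complex_of_real x) \<partial>lborel)
      + complex_of_real (f y) * Complex 0 (- 2 * arctan (1 / e)) = stieltjes \<nu> (Complex y e)"
    using eventually_at_right_less[of 0]
  proof eventually_elim
    case (elim e)
    let ?k = "\<lambda>x. 1 / (Complex y e - complex_of_real x)"
    have k_bound: "norm (?k x) \<le> 1 / e" for x
      using norm_inverse_power_le[of "Complex y e" x 1] elim by simp
    have k_int: "integrable lborel (\<lambda>x. complex_of_real (h x) * ?k x)"
      if "integrable lborel h" for h :: "real \<Rightarrow> real"
    proof (rule Bochner_Integration.integrable_bound[of _ "\<lambda>x. h x / e"])
      show "AE x in lborel. norm (complex_of_real (h x) * ?k x) \<le> norm (h x / e)"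
      proof (intro AE_I2)
        fix x
        have "norm (complex_of_real (h x) * ?k x) = \<bar>h x\<bar> * norm (?k x)"
          by (simp only: norm_mult norm_of_real)
        also have "\<dots> \<le> \<bar>h x\<bar> * (1 / e)"
          by (intro mult_left_mono k_bound) simp
        finally show "norm (complex_of_real (h x) * ?k x) \<le> norm (h x / e)"
          using elim by simp
      qed
      have [measurable]: "h \<in> borel_measurable borel"
        using borel_measurable_integrable[OF that(1)] by simp
      show "(\<lambda>x. complex_of_real (h x) * ?k x) \<in> borel_measurable lborel" by measurable
    qed (use that in simp)
    have k_eq: "?k x = Complex ((y - x) / ((y - x)\<^sup>2 + e\<^sup>2)) (- (e / ((y - x)\<^sup>2 + e\<^sup>2)))" for x
      by (simp add: complex_eq_iff Re_divide Im_divide)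
    \<comment> \<open>The real part vanishes by oddness about \<open>y\<close>; the imaginary part
      is minus the integrated Cauchy kernel.\<close>
    have \<phi>_k: "(\<integral>x. complex_of_real (\<phi> x) * ?k x \<partial>lborel) = Complex 0 (- 2 * arctan (1 / e))"
    proof (rule complex_eqI)
      have "Re (\<integral>x. complex_of_real (\<phi> x) * ?k x \<partial>lborel) = (\<integral>x. Re (complex_of_real (\<phi> x) * ?k x) \<partial>lborel)"
        by (rule integral_Re[OF k_int[OF \<phi>_int], symmetric])
      also have "\<dots> = (\<integral>x. \<phi> x * ((y - x) / ((y - x)\<^sup>2 + e\<^sup>2)) \<partial>lborel)"
        unfolding k_eq by simp
      also have "\<dots> = 0"
        by (rule integral_odd_eq_0[of _ y]) (auto simp: \<phi>_def indicator_def power2_commute divide_simps)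
      finally show "Re (\<integral>x. complex_of_real (\<phi> x) * ?k x \<partial>lborel) = Re (Complex 0 (- 2 * arctan (1 / e)))"
        by simp
      have "Im (\<integral>x. complex_of_real (\<phi> x) * ?k x \<partial>lborel) = (\<integral>x. Im (complex_of_real (\<phi> x) * ?k x) \<partial>lborel)"
        by (rule integral_Im[OF k_int[OF \<phi>_int], symmetric])
      also have "\<dots> = (\<integral>x. - (\<phi> x * (e / ((y - x)\<^sup>2 + e\<^sup>2))) \<partial>lborel)"
        unfolding k_eq by simp
      also have "\<dots> = - (2 * arctan (1 / e))"
        using integral_Cauchy_kernel[OF elim, of y] unfolding \<phi>_def Bochner_Integration.integral_minus by simp
      finally show "Im (\<integral>x. complex_of_real (\<phi> x) * ?k x \<partial>lborel) = Im (Complex 0 (- 2 * arctan (1 / e)))"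
        by simp
    qed
    have "stieltjes \<nu> (Complex y e) = (\<integral>x. f x *\<^sub>R ?k x \<partial>lborel)"
      unfolding stieltjes_def \<nu>_eq using f_nonneg by (subst integral_density) auto
    also have "\<dots> = (\<integral>x. complex_of_real (r x) * ?k x + complex_of_real (f y) * (complex_of_real (\<phi> x) * ?k x) \<partial>lborel)"
      by (intro Bochner_Integration.integral_cong refl) (simp add: r_def scaleR_conv_of_real algebra_simps diff_divide_distrib)
    also have "\<dots> = (\<integral>x. complex_of_real (r x) * ?k x \<partial>lborel)
        + complex_of_real (f y) * (\<integral>x. complex_of_real (\<phi> x) * ?k x \<partial>lborel)"
      using k_int[OF r_int] k_int[OF \<phi>_int]
      by (subst Bochner_Integration.integral_add) (auto simp del: times_divide_eq_right)
    finally show ?case unfolding \<phi>_k by simp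
  qed
  ultimately show ?thesis
    unfolding H by (auto elim: Lim_transform_eventually)
qed

section \<open>The continuity equation for the density\<close>

context burgers_flow
begin

lemma green_boundary_value:
  assumes "t > 0" "has_pdf (\<mu> t) (f)" "f differentiable (at u)"
  shows "((\<lambda>e. G t (Complex u e)) \<longlongrightarrow>
           complex_of_real pi * Complex (hilbert_transform (f) u) (- f u)) (at_right 0)"
  unfolding green_eq_stieltjes
  using assms real_distribution[of t] by (intro stieltjes_boundary_value) auto

text \<open>The bound \<open>1 / sqrt t\<close> on the Green's function passes to its boundary
  value, whose real part is pi times the Hilbert transform.\<close>

lemma hilbert_transform_bounded:
  assumes "t > 0" "has_pdf (\<mu> t) (f)" "f differentiable (at u)"
  shows "\<bar>hilbert_transform (f) u\<bar> \<le> 1 / (pi * sqrt t)"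
proof -
  let ?B = "complex_of_real pi * Complex (hilbert_transform (f) u) (- f u)"
  have "norm ?B \<le> 1 / sqrt t"
  proof (rule tendsto_upperbound)
    show "((\<lambda>e. norm (G t (Complex u e))) \<longlongrightarrow> norm ?B) (at_right 0)"
      by (intro tendsto_norm green_boundary_value assms)
    show "\<forall>\<^sub>F e in at_right 0. norm (G t (Complex u e)) \<le> 1 / sqrt t"
      using eventually_at_right_less[of 0] by eventually_elim (use assms in \<open>simp add: norm_green_le\<close>)
  qed simp
  moreover have "pi * \<bar>hilbert_transform (f) u\<bar> \<le> norm ?B"
    using abs_Re_le_cmod[of ?B] by (simp add: abs_mult)
  ultimately have "pi * \<bar>hilbert_transform (f) u\<bar> \<le> 1 / sqrt t" by linarith
  then show ?thesis using assms(1) by (simp add: field_simps)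
qed

text \<open>At a zero of the nonnegative density both derivatives of \<rho> vanish. The product with
  the Hilbert transform then has derivative 0 as well, since its difference quotient is that of
  \<rho> times a bounded factor; regularity of the Hilbert transform at \<open>y\<close> does not
  enter.\<close>

lemma continuity_equation_at_zero:
  assumes t: "t > 0" and pdf: "\<And>s. s > 0 \<Longrightarrow> has_pdf (\<mu> s) (\<rho> s)"
    and diff_x: "\<forall>\<^sub>F u in nhds y. \<rho> t differentiable (at u)"
    and diff_t: "(\<lambda>s. \<rho> s y) differentiable (at t)"
    and zero: "\<rho> t y = 0"
  shows "((\<lambda>s. \<rho> s y) has_real_derivative 0) (at t)"
    and "((\<lambda>u. \<rho> t u * hilbert_transform (\<rho> t) u) has_real_derivative 0) (at y)"
proof -
  have nonneg: "\<rho> s u \<ge> 0" if "s > 0" for s u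
    using pdf[OF that] by (simp add: has_pdf_def)
  obtain a where a: "((\<lambda>s. \<rho> s y) has_real_derivative a) (at t)"
    using diff_t by (auto simp: real_differentiable_def)
  moreover have "a = 0"
    \<comment> \<open>The radius \<open>t\<close> of the neighbourhood keeps \<open>s\<close>
      positive, where \<open>\<rho> s\<close> is a density and hence nonnegative.\<close>
    by (rule DERIV_local_min[OF a t]) (use zero nonneg in \<open>auto simp: abs_less_iff\<close>)
  ultimately show "((\<lambda>s. \<rho> s y) has_real_derivative 0) (at t)" by simp
  obtain b where b: "(\<rho> t has_real_derivative b) (at y)"
    using eventually_nhds_x_imp_x[OF diff_x] by (auto simp: real_differentiable_def)
  moreover have "b = 0"
    by (rule DERIV_local_min[OF b zero_less_one]) (use zero nonneg[OF t] in auto)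
  ultimately have "((\<lambda>u. \<rho> t u / (u - y)) \<longlongrightarrow> 0) (at y)"
    using zero by (simp add: has_field_derivative_iff)
  then have lim: "((\<lambda>u. norm (\<rho> t u / (u - y)) * (1 / (pi * sqrt t))) \<longlongrightarrow> 0) (at y)"
    by (intro tendsto_mult_left_zero tendsto_norm_zero)
  have "\<forall>\<^sub>F u in at y. \<rho> t differentiable (at u)"
    using diff_x by (simp add: eventually_at_filter eventually_mono)
  then have "\<forall>\<^sub>F u in at y. norm (\<rho> t u * hilbert_transform (\<rho> t) u / (u - y))
      \<le> norm (\<rho> t u / (u - y)) * (1 / (pi * sqrt t))"
  proof eventually_elim
    case (elim u)
    have "norm (\<rho> t u * hilbert_transform (\<rho> t) u / (u - y))
        = norm (\<rho> t u / (u - y)) * \<bar>hilbert_transform (\<rho> t) u\<bar>"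
      by (simp add: abs_mult abs_divide)
    also have "\<dots> \<le> norm (\<rho> t u / (u - y)) * (1 / (pi * sqrt t))"
      by (intro mult_left_mono hilbert_transform_bounded[OF t pdf[OF t] elim]) simp
    finally show ?case .
  qed
  then have "((\<lambda>u. \<rho> t u * hilbert_transform (\<rho> t) u / (u - y)) \<longlongrightarrow> 0) (at y)"
    by (rule Lim_null_comparison[OF _ lim])
  then show "((\<lambda>u. \<rho> t u * hilbert_transform (\<rho> t) u) has_real_derivative 0) (at y)"
    using zero by (simp add: has_field_derivative_iff)
qed

text \<open>With \<open>W\<close> the boundary value of the Green's function,
  \<open>Im W = - pi \<rho>\<close> and \<open>Im (W^2)\<close> is \<open>- 2 pi^2\<close> times
  \<rho> times its Hilbert transform. The claim is thus the imaginary part of the Burgers equation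
  in conservation form, \<open>W_t + (W^2 / 2)_x = 0\<close>, on the real line.\<close>

lemma continuity_equation_at_positive:
  assumes t: "t > 0" and pdf: "\<And>s. s > 0 \<Longrightarrow> has_pdf (\<mu> s) (\<rho> s)"
    and diff_x: "\<forall>\<^sub>F u in nhds y. \<rho> t differentiable (at u)"
    and diff_s: "\<forall>\<^sub>F s in nhds t. \<rho> s differentiable (at y)"
    and pos: "\<rho> t y > 0"
  obtains D where "((\<lambda>s. \<rho> s y) has_real_derivative - pi * D) (at t)"
    "((\<lambda>u. \<rho> t u * hilbert_transform (\<rho> t) u) has_real_derivative D) (at y)"
proof -
  define a where "a = complex_of_real pi * Complex (hilbert_transform (\<rho> t) y) (- \<rho> t y)"
  define \<zeta> where "\<zeta> = complex_of_real y - complex_of_real t * a"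
  have \<zeta>: "Im \<zeta> > 0" using t pos by (simp add: \<zeta>_def a_def)
  note G0_deriv = green_0_has_field_derivative(1)
  have lim: "((\<lambda>e. G t (Complex y e)) \<longlongrightarrow> a) (at_right 0)"
    unfolding a_def by (rule green_boundary_value[OF t pdf[OF t] eventually_nhds_x_imp_x[OF diff_x]])
  \<comment> \<open>The functional equation in the limit \<open>e\<close> to 0. Positivity of the
    density places \<zeta> off the real axis, where \<open>G 0\<close> is continuous.\<close>
  have G0\<zeta>: "G 0 \<zeta> = a"
  proof -
    have "((\<lambda>e. Complex y e - complex_of_real t * G t (Complex y e)) \<longlongrightarrow>
        Complex y 0 - complex_of_real t * a) (at_right 0)"
      by (intro tendsto_intros lim)
    then have "((\<lambda>e. Complex y e - complex_of_real t * G t (Complex y e)) \<longlongrightarrow> \<zeta>) (at_right 0)"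
      by (simp add: \<zeta>_def complex_of_real_def)
    then have "((\<lambda>e. G 0 (Complex y e - complex_of_real t * G t (Complex y e))) \<longlongrightarrow> G 0 \<zeta>) (at_right 0)"
      by (rule isCont_tendsto_compose[OF DERIV_isCont[OF G0_deriv[OF \<zeta>]]])
    moreover have "\<forall>\<^sub>F e in at_right 0. G 0 (Complex y e - complex_of_real t * G t (Complex y e)) = G t (Complex y e)"
      using eventually_at_right_less[of 0]
    proof eventually_elim
      case (elim e)
      show ?case using green_subordination[of t "Complex y e"] t elim by simp
    qed
    ultimately have "((\<lambda>e. G t (Complex y e)) \<longlongrightarrow> G 0 \<zeta>) (at_right 0)"
      by (rule Lim_transform_eventually)
    with lim show ?thesis by (rule tendsto_unique[OF trivial_limit_at_right_real, symmetric])
  qed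
  define b where "b = deriv (G 0) \<zeta>"
  have a0: "a \<noteq> 0" using pos by (auto simp: a_def complex_eq_iff)
  have \<zeta>y: "\<zeta> + complex_of_real t * G 0 \<zeta> = complex_of_real y"
    unfolding G0\<zeta> by (simp add: \<zeta>_def)
  \<comment> \<open>The space derivative of \<open>W^2 / 2\<close> at \<open>y\<close>; the time
    derivative of \<open>W\<close> at \<open>t\<close> will turn out to be
    \<open>- q\<close>.\<close>
  define q where "q = a * b / (1 + complex_of_real t * b)"

  obtain g \<delta> where \<delta>: "\<delta> > 0" and g: "g (complex_of_real y) = \<zeta>"
      "(g has_field_derivative 1 / (1 + complex_of_real t * b)) (at (complex_of_real y))"
    and nz: "1 + complex_of_real t * b \<noteq> 0"
    and g_lim: "\<And>u. \<bar>u - y\<bar> < \<delta> \<Longrightarrow>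
       ((\<lambda>e. G t (Complex u e)) \<longlongrightarrow> G 0 (g (complex_of_real u))) (at_right 0)"
    unfolding b_def by (rule green_boundary_extension[OF t \<zeta> \<zeta>y]) blast
  let ?W = "\<lambda>u. G 0 (g (complex_of_real u))"
  have ev_x: "\<forall>\<^sub>F u in nhds y. \<rho> t u * hilbert_transform (\<rho> t) u = - 1 / (2 * pi\<^sup>2) * Im ((?W u)\<^sup>2)"
  proof -
    have "\<forall>\<^sub>F u in nhds y. \<bar>u - y\<bar> < \<delta>"
      unfolding eventually_nhds_metric dist_real_def using \<delta> by blast
    with diff_x show ?thesis
    proof eventually_elim
      case (elim u)
      have "complex_of_real pi * Complex (hilbert_transform (\<rho> t) u) (- \<rho> t u) = ?W u"
        by (rule tendsto_unique[OF trivial_limit_at_right_real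
              green_boundary_value[OF t pdf[OF t] elim(1)] g_lim[OF elim(2)]])
      from this[symmetric] show ?case
        by (simp add: power2_eq_square)
    qed
  qed
  have "((\<lambda>z. G 0 (g z)) has_field_derivative b * (1 / (1 + complex_of_real t * b))) (at (complex_of_real y))"
    by (rule DERIV_chain2[OF _ g(2)]) (simp add: g(1) b_def G0_deriv \<zeta>)
  from DERIV_power[OF this, of 2]
  have "((\<lambda>z. (G 0 (g z))\<^sup>2) has_field_derivative 2 * q) (at (complex_of_real y))"
    by (simp add: g(1) G0\<zeta> q_def mult.commute)
  then have "((\<lambda>u. (?W u)\<^sup>2) has_vector_derivative 2 * q) (at y)"
    by (rule has_vector_derivative_real_field)
  from has_field_derivative_Im[OF this]
  have "((\<lambda>u. - 1 / (2 * pi\<^sup>2) * Im ((?W u)\<^sup>2)) has_real_derivative - 1 / (2 * pi\<^sup>2) * Im (2 * q)) (at y)"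
    by (rule DERIV_cmult)
  then have D: "((\<lambda>u. \<rho> t u * hilbert_transform (\<rho> t) u) has_real_derivative - 1 / (2 * pi\<^sup>2) * Im (2 * q)) (at y)"
    using DERIV_cong_ev[OF refl ev_x refl] by blast

  \<comment> \<open>Solving \<open>z + s * G 0 z = y\<close> for \<open>s\<close> gives
    \<open>s = h z\<close>. The inverse of \<open>h\<close> sends \<open>s\<close> to the starting
    point of the characteristic that reaches \<open>y\<close> at time \<open>s\<close>; zeros of
    \<open>G 0\<close> are removed so that \<open>h\<close> is holomorphic.\<close>
  define S where "S = {z. Im z > 0} \<inter> G 0 -` (- {0})"
  define h where "h z = (complex_of_real y - z) / G 0 z" for z
  have S: "open S" unfolding S_def
    by (intro continuous_open_preimage holomorphic_on_imp_continuous_on green_0_holomorphic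
        open_halfspace_Im_gt) auto
  have \<zeta>S: "\<zeta> \<in> S" using \<zeta> a0 by (simp add: S_def G0\<zeta>)
  have h_hol: "h holomorphic_on S"
    unfolding h_def
    by (intro holomorphic_intros holomorphic_on_subset[OF green_0_holomorphic]) (auto simp: S_def)
  have h\<zeta>: "h \<zeta> = complex_of_real t" unfolding h_def G0\<zeta> using a0 by (simp add: \<zeta>_def)
  have "(h has_field_derivative (- 1 * G 0 \<zeta> - (complex_of_real y - \<zeta>) * b) / (G 0 \<zeta> * G 0 \<zeta>)) (at \<zeta>)"
    unfolding h_def using a0
    by (intro DERIV_divide) (auto intro!: derivative_eq_intros G0_deriv \<zeta> simp: b_def G0\<zeta>)
  moreover have "(- 1 * G 0 \<zeta> - (complex_of_real y - \<zeta>) * b) / (G 0 \<zeta> * G 0 \<zeta>) = - (1 + complex_of_real t * b) / a"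
    unfolding G0\<zeta> using a0 by (simp add: \<zeta>_def field_simps)
  ultimately have h_deriv: "(h has_field_derivative - (1 + complex_of_real t * b) / a) (at \<zeta>)" by simp
  have h_nz: "- (1 + complex_of_real t * b) / a \<noteq> 0"
    using nz a0 unfolding divide_eq_0_iff neg_equal_0_iff_equal by blast
  obtain k T where T: "open T" "complex_of_real t \<in> T" and k: "k (complex_of_real t) = \<zeta>"
      "(k has_field_derivative 1 / (- (1 + complex_of_real t * b) / a)) (at (complex_of_real t))"
    and k_inv: "\<And>w. w \<in> T \<Longrightarrow> k w \<in> S \<and> h (k w) = w"
    by (rule holomorphic_local_inverse[OF h_hol S \<zeta>S h_deriv h_nz, unfolded h\<zeta>]) blast
  have ev_t: "\<forall>\<^sub>F s in nhds t. \<rho> s y = - 1 / pi * Im (G 0 (k (complex_of_real s)))"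
  proof -
    have "((\<lambda>s. complex_of_real s) \<longlongrightarrow> complex_of_real t) (nhds t)"
      by (intro tendsto_of_real filterlim_ident)
    then have "\<forall>\<^sub>F s in nhds t. complex_of_real s \<in> T"
      using T by (rule topological_tendstoD)
    moreover have "\<forall>\<^sub>F s in nhds t. s > 0"
      using eventually_nhds_in_open[of "{0<..}" t] t by simp
    ultimately show ?thesis using diff_s
    proof eventually_elim
      case (elim s)
      let ?z = "k (complex_of_real s)"
      have z: "Im ?z > 0" "G 0 ?z \<noteq> 0" "h ?z = complex_of_real s"
        using k_inv[OF elim(1)] by (auto simp: S_def)
      then have "?z + complex_of_real s * G 0 ?z = complex_of_real y"
        by (simp add: h_def field_simps)
      \<comment> \<open>The boundary extension is applied afresh at each time \<open>s\<close> near
        \<open>t\<close>, from the starting point \<open>?z\<close>; only the limit at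
        \<open>u = y\<close> is used.\<close>
      then obtain g' \<delta>' where "\<delta>' > 0" "g' (complex_of_real y) = ?z" "\<And>u. \<bar>u - y\<bar> < \<delta>' \<Longrightarrow>
         ((\<lambda>e. G s (Complex u e)) \<longlongrightarrow> G 0 (g' (complex_of_real u))) (at_right 0)"
        by (rule green_boundary_extension[OF elim(2) z(1)]) blast
      then have "((\<lambda>e. G s (Complex y e)) \<longlongrightarrow> G 0 ?z) (at_right 0)"
        by (metis abs_zero cancel_comm_monoid_add_class.diff_cancel)
      from tendsto_unique[OF trivial_limit_at_right_real
          green_boundary_value[OF elim(2) pdf[OF elim(2)] elim(3)] this]
      have "Im (complex_of_real pi * Complex (hilbert_transform (\<rho> s) y) (- \<rho> s y)) = Im (G 0 ?z)"
        by (rule arg_cong)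
      then have "Im (G 0 ?z) = - (pi * \<rho> s y)" by simp
      then show ?case by simp
    qed
  qed
  have "((\<lambda>z. G 0 (k z)) has_field_derivative b * (1 / (- (1 + complex_of_real t * b) / a))) (at (complex_of_real t))"
    by (rule DERIV_chain2[where f = "G 0", OF _ k(2)]) (simp add: k(1) b_def G0_deriv \<zeta>)
  moreover have "b * (1 / (- (1 + complex_of_real t * b) / a)) = - q"
  proof -
    have "b * (1 / (- c / a)) = - (a * b / c)" for c by simp
    then show ?thesis unfolding q_def .
  qed
  ultimately have "((\<lambda>z. G 0 (k z)) has_field_derivative - q) (at (complex_of_real t))"
    by simp
  then have "((\<lambda>s. G 0 (k (complex_of_real s))) has_vector_derivative - q) (at t)"
    by (rule has_vector_derivative_real_field)
  from has_field_derivative_Im[OF this]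
  have "((\<lambda>s. - 1 / pi * Im (G 0 (k (complex_of_real s)))) has_real_derivative - 1 / pi * Im (- q)) (at t)"
    by (rule DERIV_cmult)
  then have "((\<lambda>s. \<rho> s y) has_real_derivative - 1 / pi * Im (- q)) (at t)"
    using DERIV_cong_ev[OF refl ev_t refl] by blast
  moreover have "- 1 / pi * Im (- q) = - pi * (- 1 / (2 * pi\<^sup>2) * Im (2 * q))"
    by (simp add: power2_eq_square)
  ultimately have "((\<lambda>s. \<rho> s y) has_real_derivative - pi * (- 1 / (2 * pi\<^sup>2) * Im (2 * q))) (at t)"
    by (simp only:)
  then show ?thesis by (rule that[OF _ D])
qed

end

section \<open>Both conclusions for the hydrodynamic limit of the Dyson model\<close>

theorem theorem1p2:
  fixes M :: "'w measure" and \<beta> :: real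
    and x :: "nat \<Rightarrow> nat \<Rightarrow> real"
    and B X :: "nat \<Rightarrow> nat \<Rightarrow> real \<Rightarrow> 'w \<Rightarrow> real"
    and \<mu> :: "real \<Rightarrow> real measure"
    and \<rho> :: "real \<Rightarrow> real \<Rightarrow> real"
    and E :: "(real \<times> real) set"
  assumes "\<beta> \<ge> 1"
    and "dyson_hydrodynamic_limit M \<beta> x B X \<mu>"
    and "has_density_process \<mu> \<rho>"
    and "piecewise_differentiable_off E \<rho>"
    and "\<And>t. t > 0 \<Longrightarrow> \<exists>p>1. in_Lp p (\<rho> t)"
    and "\<And>t. t > 0 \<Longrightarrow> \<exists>p>1. in_Lp p (pw_deriv_t E \<rho> t)"
    and "\<And>t. t > 0 \<Longrightarrow> \<exists>p>1. in_Lp p (pw_deriv_x E \<rho> t)"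
    and "solves_complex_burgers (green \<mu>)"
  shows "(\<forall>t>0. \<forall>y. (t, y) \<notin> E \<longrightarrow>
            (\<exists>D. ((\<lambda>u. \<rho> t u * hilbert_transform (\<rho> t) u) has_real_derivative D) (at y) \<and>
                 pw_deriv_t E \<rho> t y + pi * D = 0))
       \<and> (\<forall>t\<ge>0. \<forall>z. Im z \<noteq> 0 \<longrightarrow>
            green \<mu> t z = green \<mu> 0 (z - complex_of_real t * green \<mu> t z))"
proof -
  interpret burgers_flow \<mu>
    using assms(2,8) by unfold_locales (auto simp: dyson_hydrodynamic_limit_def)
  have "\<exists>D. ((\<lambda>u. \<rho> t u * hilbert_transform (\<rho> t) u) has_real_derivative D) (at y) \<and>
      pw_deriv_t E \<rho> t y + pi * D = 0" if t: "t > 0" and ty: "(t, y) \<notin> E" for t y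
  proof -
    have pdf: "has_pdf (\<mu> s) (\<rho> s)" if "s > 0" for s
      using assms(3) that by (simp add: has_density_process_def)
    have diff: "(\<lambda>r. \<rho> r u) differentiable (at s)" "\<rho> s differentiable (at u)"
      if "s > 0" "(s, u) \<notin> E" for s u
      using assms(4) that by (auto simp: piecewise_differentiable_off_def)
    \<comment> \<open>As \<open>E\<close> is relatively closed, the pieces form an open subset of
      the plane. Hence \<rho> is differentiable in space at all points near \<open>(t, y)\<close>:
      at time \<open>t\<close> for neighbouring \<open>u\<close>, and at \<open>y\<close> for
      neighbouring times \<open>s\<close>.\<close>
    obtain C where C: "closed C" "E = ({0<..} \<times> UNIV) \<inter> C"
      using assms(4) by (auto simp: piecewise_differentiable_off_def closedin_closed)
    define U where "U = ({0<..} \<times> UNIV) \<inter> - C"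
    have U: "open U" "(t, y) \<in> U"
      using C t ty by (auto simp: U_def intro!: open_Int open_Times)
    have U_diff: "\<rho> s differentiable (at u)" if "(s, u) \<in> U" for s u
      using that C by (intro diff) (auto simp: U_def)
    have "((\<lambda>u. (t, u)) \<longlongrightarrow> (t, y)) (nhds y)" "((\<lambda>s. (s, y)) \<longlongrightarrow> (t, y)) (nhds t)"
      by (intro tendsto_Pair tendsto_const filterlim_ident)+
    from this[THEN topological_tendstoD, OF U]
    have ev: "\<forall>\<^sub>F u in nhds y. \<rho> t differentiable (at u)" "\<forall>\<^sub>F s in nhds t. \<rho> s differentiable (at y)"
      by (auto elim: eventually_mono simp: U_diff)
    obtain D where D: "((\<lambda>s. \<rho> s y) has_real_derivative - pi * D) (at t)"
      "((\<lambda>u. \<rho> t u * hilbert_transform (\<rho> t) u) has_real_derivative D) (at y)"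
    proof (cases "\<rho> t y = 0")
      case True
      then show ?thesis
        using continuity_equation_at_zero[where \<rho> = \<rho>, OF t pdf ev(1) diff(1)[OF t ty]] that[of 0] by simp
    next
      case False
      moreover have "\<rho> t y \<ge> 0" using pdf[OF t] by (simp add: has_pdf_def)
      ultimately have "\<rho> t y > 0" by simp
      then show ?thesis
        using continuity_equation_at_positive[where \<rho> = \<rho>, OF t pdf ev] that by blast
    qed
    have "pw_deriv_t E \<rho> t y = - pi * D"
      using ty DERIV_imp_deriv[OF D(1)] by (simp add: pw_deriv_t_def)
    with D(2) show ?thesis by (intro exI[of _ D]) simp
  qed
  then show ?thesis using green_functional_equation by blast
qed

end
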